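(* Let $\mathcal{S}$ be a reduced linear subspace of $\mathrm{Mat}_{m,n}(\mathbb{K})$. Set $r:=\mathrm{urk}(\mathcal{S})$ and assume $\#\mathbb{K}>r\geq 2$. (a) If $\mathcal{S}$ has the column property and $r\geq 4$, then $\mathrm{trk}(\mathcal{S})\leq\binom{r}{2}$. (b) If $\mathcal{S}$ is semi-primitive, then $\mathrm{trk}(\mathcal{S})\leq 3+\binom{r-1}{2}$.
   Context: $\mathrm{urk}$ is the maximal rank in a space; $\mathrm{trk}(\mathcal{S}):=\max_{x\in\mathbb{K}^n}\dim\{Mx\mid M\in\mathcal{S}\}$. Matrix spaces are equivalent ($\sim$) if $\mathcal{M}=P\mathcal{M}'Q$ with $P,Q$ invertible. $\mathcal{S}$ is reduced if no nonzero vector is annihilated by all its matrices and the sum of column spaces of its matrices is $\mathbb{K}^m$. A subspace is defective if none of its matrices has rank equal to its number of columns. $\mathcal{S}$ is $(r,s)$-decomposed ($0\le r\le m$, $1\le s\le n$) if every $M\in\mathcal{S}$ is of the form $\begin{bmatrix} ?_{r\times s}& C(M)\\ B(M)&0_{(m-r)\times(n-s)}\end{bmatrix}$, with lower space $B(\mathcal{S})$; $\mathcal{S}$ has the column property if for every such $(r,s)$ and every $(r,s)$-decomposed $\mathcal{S}'\sim\mathcal{S}$, the lower space of $\mathcal{S}'$ is defective. For an operator space $\mathcal{T}\subseteq\mathcal{L}(U,V)$: $\mathcal{T}$ is $c$-defective if $\dim\ker f\geq c$ for all $f\in\mathcal{T}$; its defectiveness index is the greatest such $c$; $\mathcal{T}$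 is semi-primitive if it is reduced and there is no linear hyperplane $U'$ of $U$ such that $\{f_{|U'}\mid f\in\mathcal{T}\}$ is $c$-defective, $c$ being the defectiveness index of $\mathcal{T}$. A matrix space in $\mathrm{Mat}_{m,n}(\mathbb{K})$ is semi-primitive if the corresponding subspace of $\mathcal{L}(\mathbb{K}^n,\mathbb{K}^m)$ is. *)

theory Defs
  imports "HOL-Analysis.Analysis"
begin

(* Matrices in Mat_{m,n}(K) are elements of 'a^'n^'m ('m rows, 'n columns),
   for a field 'a and arbitrary finite (nonempty) index types 'm, 'n. *)

definition matrix_subspace :: "('a::field^'n^'m) set \<Rightarrow> bool" where
  "matrix_subspace S \<longleftrightarrow> 0 \<in> S \<and> (\<forall>A\<in>S. \<forall>B\<in>S. A + B \<in> S)
     \<and> (\<forall>c. \<forall>A\<in>S. (\<chi> i j. c * A $ i $ j) \<in> S)"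

definition urk :: "('a::field^'n^'m) set \<Rightarrow> nat" where
  "urk S = Max (rank ` S)"

definition trk :: "('a::field^'n^'m) set \<Rightarrow> nat" where
  "trk S = Max {vec.dim {M *v x | M. M \<in> S} | x. True}"

definition reduced :: "('a::field^'n^'m) set \<Rightarrow> bool" where
  "reduced S \<longleftrightarrow> (\<forall>x. (\<forall>M\<in>S. M *v x = 0) \<longrightarrow> x = 0)
     \<and> vec.span (\<Union>M\<in>S. range (\<lambda>x. M *v x)) = UNIV"

definition mat_equiv :: "('a::field^'n^'m) set \<Rightarrow> ('a^'n^'m) set \<Rightarrow> bool" where
  "mat_equiv S S' \<longleftrightarrow> (\<exists>(P::'a^'m^'m) (Q::'a^'n^'n).
      invertible P \<and> invertible Q \<and> S = (\<lambda>M. P ** M ** Q) ` S')"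

definition subrank :: "'a::field^'n^'m \<Rightarrow> 'm set \<Rightarrow> 'n set \<Rightarrow> nat" where
  "subrank M I J = vec.dim {(\<chi> i. if i \<in> I then M $ i $ j else 0) | j. j \<in> J}"

text \<open>(r,s)-decomposition, up to a renaming of the row and column indices:
  R is the set of the r "upper" rows, C the set of the s "left" columns;
  the block (rows outside R) x (columns outside C) vanishes.\<close>
definition decomposed :: "('a::field^'n^'m) set \<Rightarrow> nat \<Rightarrow> nat \<Rightarrow> 'm set \<Rightarrow> 'n set \<Rightarrow> bool" where
  "decomposed S r s R C \<longleftrightarrow> card R = r \<and> card C = s \<and> 1 \<le> s \<and>
     (\<forall>M\<in>S. \<forall>i j. i \<notin> R \<longrightarrow> j \<notin> C \<longrightarrow> M $ i $ j = 0)"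

text \<open>the lower space B(S) = {B(M)} (rows outside R, columns in C) is defective:
  no matrix in it has rank equal to its number of columns s = card C\<close>
definition lower_defective :: "('a::field^'n^'m) set \<Rightarrow> 'm set \<Rightarrow> 'n set \<Rightarrow> bool" where
  "lower_defective S R C \<longleftrightarrow> (\<forall>M\<in>S. subrank M (- R) C \<noteq> card C)"

definition column_property :: "('a::field^'n^'m) set \<Rightarrow> bool" where
  "column_property S \<longleftrightarrow> (\<forall>r s R C S'. mat_equiv S' S \<longrightarrow> decomposed S' r s R C
       \<longrightarrow> lower_defective S' R C)"

text \<open>operator-space notions, for the space {x \<mapsto> Mx | M in S} restricted to a subspace U\<close>
definition c_defective_on :: "('a::field^'n^'m) set \<Rightarrow> ('a^'n) set \<Rightarrow> nat \<Rightarrow> bool" where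
  "c_defective_on S U c \<longleftrightarrow> (\<forall>M\<in>S. c \<le> vec.dim {x \<in> U. M *v x = 0})"

definition defectiveness_index :: "('a::field^'n^'m) set \<Rightarrow> nat" where
  "defectiveness_index S = (GREATEST c. c_defective_on S UNIV c)"

definition semi_primitive :: "('a::field^'n^'m) set \<Rightarrow> bool" where
  "semi_primitive S \<longleftrightarrow> reduced S \<and>
     \<not> (\<exists>U'. vec.subspace U' \<and> vec.dim U' = CARD('n) - 1 \<and>
            c_defective_on S U' (defectiveness_index S))"

end

theory Submission
  imports Defs
begin

text \<open>Both bounds rest on peeling. If \<open>P\<close> has maximal rank \<open>r\<close> and \<open>Pz = 0\<close>, then \<open>Sz\<close> lies in the image
  of \<open>P\<close>, and dividing \<open>K\<^sup>m\<close> by \<open>Sz\<close> lowers the upper rank while the column property survives. Hence the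
  column property bounds the dimension of the sum of all column spaces by \<open>r + (r - 1) + \<dots> + 1\<close>. If all
  kernels of matrices of rank \<open>r\<close> lie in a hyperplane (failure of semi-primitivity), the same peeling on this
  hyperplane gives \<open>(r - 1) + \<dots> + 1\<close>, which settles (a) outside the semi-primitive case; there (a) follows
  from (b).

  For (b) write \<open>M = [A(M) C(M); B(M) 0]\<close> with respect to \<open>P = diag (I\<^sub>r, 0)\<close>, so that
  \<open>B(M) A(M)\<^sup>k C(M) = 0\<close>. For \<open>z\<close> in the kernel of \<open>P\<close> put \<open>q = dim Sz\<close>. The map
  \<open>(M, N) \<mapsto> B(M) C(N) z\<close> is alternating, so \<open>B(S)\<close> maps \<open>Sz\<close> into dimension at most \<open>q choose 2\<close>, and peeling
  bounds the rest by \<open>(r - q) choose 2\<close>; this suffices if \<open>2 \<le> q \<le> r - 2\<close>. If \<open>q = 1\<close> for all such \<open>z\<close>,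
  which span \<open>K\<^sup>n\<close>, there are at most \<open>r\<close> rows. The cases \<open>q = r\<close> and \<open>q = r - 1\<close> use the
  polarized identities \<open>BC = 0\<close> and \<open>BAC = 0\<close>.\<close>

section \<open>Dimension counting\<close>

text \<open>The constant in (b) is r + (q choose 2) + ((r - q) choose 2) at q = 2: this expression
  is convex in q, so on 2 <= q <= r - 2 it is largest at the two ends. It differs from (r choose 2)
  by r - 4, so (a) can borrow (b) exactly from r = 4 on. The size of the field enters through one
  count: in a pencil M + tP at most rank P scalars t lower the rank below rank P. A single good
  scalar then suffices, so #K > r is enough and no determinant is expanded. Polarizing the cubic
  identity also takes a scalar other than 0 and 1. The delicate case is q = r - 1. Alternation
  controls B(S) on the copy of Sz in the domain, but a vector x outside this copy escapes it. The
  direct estimate dim B(S)x <= 2r - 5 is too large by one for r = 4 and r = 5, and for no other r >=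
  3; equality is excluded by studying an alternating pairing on that copy.\<close>

lemma span_Int_independent:
  fixes A B :: "('a::field^'n) set"
  assumes ind: "vec.independent (A \<union> B)" and disj: "A \<inter> B = {}"
  shows "vec.span A \<inter> vec.span B = {0}"
proof -
  have fin: "finite A" "finite B"
    using vec.finiteI_independent[OF ind] by auto
  have iA: "vec.independent A" and iB: "vec.independent B"
    using ind vec.independent_mono by blast+
  have "vec.dim {x + y |x y. x \<in> vec.span A \<and> y \<in> vec.span B} = vec.dim (vec.span (A \<union> B))"
    by (simp add: vec.span_Un)
  also have "\<dots> = card A + card B"
    by (metis card_Un_disjoint disj fin ind vec.dim_span_eq_card_independent)
  finally have "vec.dim (vec.span A \<inter> vec.span B) = 0"
    using vec.dim_sums_Int[OF vec.subspace_span[of A] vec.subspace_span[of B]] iA iB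
    by (simp add: vec.dim_span_eq_card_independent vec.dim_eq_card_independent)
  then show ?thesis
    using vec.span_zero by auto
qed

text \<open>Prescribing a part \<open>B\<close> of the complement is what later lets a chosen vector
  have no kernel component.\<close>

lemma complement_exists:
  fixes A B :: "('a::field^'n) set"
  assumes "vec.subspace A" "vec.subspace B" and disj: "A \<inter> B = {0}"
  obtains U where "vec.subspace U" "B \<subseteq> U" "A \<inter> U = {0}"
    "\<And>x. \<exists>a\<in>A. \<exists>u\<in>U. x = a + u" "vec.dim U + vec.dim A = CARD('n)"
proof -
  obtain B0 where B0: "B0 \<subseteq> B" "vec.independent B0" "vec.span B0 = B" "card B0 = vec.dim B"
    using vec.basis_subspace_exists[OF assms(2)] by metis
  obtain A0 where A0: "A0 \<subseteq> A" "vec.independent A0" "vec.span A0 = A" "card A0 = vec.dim A"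
    using vec.basis_subspace_exists[OF assms(1)] by metis
  have nz: "0 \<notin> A0" "0 \<notin> B0"
    using A0 B0 vec.dependent_zero by blast+
  have d0: "A0 \<inter> B0 = {}"
  proof -
    have "A0 \<inter> B0 \<subseteq> {0}" using Int_mono[OF A0(1) B0(1)] disj by simp
    then show ?thesis using nz(1) by blast
  qed
  have "vec.dim {x + y |x y. x \<in> A \<and> y \<in> B} = vec.dim A + vec.dim B"
    using vec.dim_sums_Int[OF assms(1,2)] disj by simp
  moreover have "{x + y |x y. x \<in> A \<and> y \<in> B} = vec.span (A0 \<union> B0)"
    using A0 B0 by (simp add: vec.span_Un)
  moreover have "finite A0" "finite B0"
    using A0(2) B0(2) vec.finiteI_independent by blast+
  ultimately have "vec.independent (A0 \<union> B0)"
    using A0(4) B0(4) d0 by (intro vec.card_le_dim_spanning[of _ "vec.span (A0 \<union> B0)"])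
      (simp_all add: card_Un_disjoint vec.span_superset)
  then obtain C where C: "A0 \<union> B0 \<subseteq> C" "vec.independent C" "UNIV \<subseteq> vec.span C"
    using vec.maximal_independent_subset_extend[of "A0 \<union> B0" UNIV] by auto
  let ?U = "vec.span (C - A0)"
  have CA: "A0 \<union> (C - A0) = C" using C by auto
  have int: "A \<inter> ?U = {0}"
    using span_Int_independent[of A0 "C - A0"] C CA A0 by auto
  have sum: "\<exists>a\<in>A. \<exists>u\<in>?U. x = a + u" for x
  proof -
    have "x \<in> vec.span (A0 \<union> (C - A0))" using C CA by auto
    then show ?thesis unfolding vec.span_Un using A0 by blast
  qed
  have "{x + y |x y. x \<in> A \<and> y \<in> ?U} = UNIV"
    using sum by blast
  then have "vec.dim ?U + vec.dim A = CARD('n)"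
    using vec.dim_sums_Int[OF assms(1) vec.subspace_span[of "C - A0"]] int
      vec_dim_card[where 'a='a and 'n='n] by simp
  moreover have "B \<subseteq> ?U"
    using B0(3) C(1) d0 vec.span_mono[of B0 "C - A0"] by blast
  ultimately show thesis using that[of ?U] int sum vec.subspace_span by blast
qed

lemma subspace_ker: "vec.subspace {x. A *v x = 0}" for A :: "'a::field^'n^'m"
  by (simp add: vec.subspace_def matrix_vector_right_distrib vec.scale)

lemma subspace_image_mv: "vec.subspace V \<Longrightarrow> vec.subspace ((*v) A ` V)"
  for A :: "'a::field^'n^'m"
  by (rule vec.subspace_image)

lemma dim_image_ker:
  fixes A :: "'a::field^'n^'m"
  assumes V: "vec.subspace V"
  shows "vec.dim ((*v) A ` V) + vec.dim {x\<in>V. A *v x = 0} = vec.dim V"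
proof -
  let ?K = "{x\<in>V. A *v x = 0}"
  have K: "vec.subspace ?K"
    using vec.subspace_inter[OF V subspace_ker[of A]] by (simp add: Int_def)
  obtain B0 where B0: "B0 \<subseteq> ?K" "vec.independent B0" "vec.span B0 = ?K" "card B0 = vec.dim ?K"
    by (rule vec.basis_subspace_exists[OF K])
  obtain B where B: "B0 \<subseteq> B" "B \<subseteq> V" "vec.independent B" "V \<subseteq> vec.span B"
    using vec.maximal_independent_subset_extend[of B0 V] B0(1,2) by (metis (no_types, lifting) mem_Collect_eq subset_iff)
  have sB: "vec.span B = V" by (rule vec.span_subspace[OF B(2,4) V])
  have fin: "finite B" using B vec.finiteI_independent by blast
  let ?C = "B - B0"
  have BC: "B0 \<union> ?C = B" using B by auto
  have int: "vec.span B0 \<inter> vec.span ?C = {0}"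
    using span_Int_independent[of B0 ?C] BC B by auto
  have "x = 0" if "x \<in> vec.span ?C" "A *v x = 0" for x
  proof -
    have "x \<in> V" using that(1) sB vec.span_mono[of ?C B] by auto
    then show ?thesis using that int B0 by auto
  qed
  then have inj: "inj_on ((*v) A) (vec.span ?C)"
    by (simp add: vec.inj_on_iff_eq_0)
  have "(*v) A ` V = (*v) A ` vec.span ?C"
  proof
    show "(*v) A ` V \<subseteq> (*v) A ` vec.span ?C"
    proof
      fix y assume "y \<in> (*v) A ` V"
      then obtain x where x: "x \<in> V" "y = A *v x" by auto
      then have "x \<in> vec.span (B0 \<union> ?C)" using sB BC by simp
      then obtain a c where "x = a + c" "a \<in> vec.span B0" "c \<in> vec.span ?C"
        unfolding vec.span_Un by blast
      moreover have "A *v a = 0" using B0 calculation by auto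
      ultimately show "y \<in> (*v) A ` vec.span ?C"
        using x by (auto simp: matrix_vector_right_distrib)
    qed
    show "(*v) A ` vec.span ?C \<subseteq> (*v) A ` V"
      using sB vec.span_mono[of ?C B] by auto
  qed
  then have "vec.dim ((*v) A ` V) = vec.dim (vec.span ?C)"
    using vec.dim_image_eq[of "(*v) A" "vec.span ?C"] inj by (simp add: vec.span_span)
  also have "\<dots> = card ?C"
    using vec.independent_mono[OF B(3), of ?C] by (simp add: vec.dim_eq_card_independent)
  finally show ?thesis
    using B0(4) card_Diff_subset[of B0 B] B sB fin vec.dim_eq_card_independent[OF B(3)]
    by (metis add.commute card_mono finite_subset le_add_diff_inverse vec.dim_span)
qed

text \<open>Coordinates in a basis of the column space factor \<open>A\<close> through that space,
  so the rows are combinations of one coefficient row per basis vector. Used for \<open>A\<close>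
  and its transpose, this passes from the row rank, which defines \<open>rank\<close>, to the
  image.\<close>

lemma dim_rows_le_columns:
  fixes A :: "'a::field^'n^'m"
  shows "vec.dim (rows A) \<le> vec.dim (columns A)"
proof -
  obtain B where B: "vec.independent B" "columns A \<subseteq> vec.span B" "card B = vec.dim (columns A)"
    using vec.basis_exists[of "columns A"] by metis
  have fin: "finite B" using B vec.finiteI_independent by blast
  define r where "r c = (\<chi> j. vec.representation B (column j A) c)" for c
  have "row i A \<in> vec.span (r ` B)" for i
  proof -
    have "A $ i $ j = (\<Sum>c\<in>B. vec.representation B (column j A) c * c $ i)" for j
    proof -
      have "column j A \<in> vec.span B" using B by (auto simp: columns_def)
      then have "(\<Sum>c\<in>B. vec.representation B (column j A) c *s c) = column j A"
        using vec.sum_representation_eq[OF B(1) _ fin] by blast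
      from arg_cong[OF this, of "\<lambda>v. v $ i"] show ?thesis
        by (simp add: sum_component column_def)
    qed
    then have "row i A = (\<Sum>c\<in>B. (c $ i) *s r c)"
      by (simp add: vec_eq_iff sum_component row_def r_def mult.commute)
    then show ?thesis
      by (simp add: vec.span_sum vec.span_scale vec.span_base)
  qed
  then have "vec.dim (rows A) \<le> card (r ` B)"
    by (intro vec.dim_le_card) (auto simp: rows_def fin)
  also have "\<dots> \<le> card B" using fin by (rule card_image_le)
  finally show ?thesis using B by simp
qed

lemma rank_dim_range_field:
  fixes A :: "'a::field^'n^'m"
  shows "rank A = vec.dim (range ((*v) A))"
proof -
  have "vec.dim (rows A) = vec.dim (columns A)"
    using dim_rows_le_columns[of A] dim_rows_le_columns[of "transpose A"]
    by (simp add: rows_transpose columns_transpose)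
  moreover have "vec.span (columns A) = range ((*v) A)"
  proof (rule vec.span_subspace)
    show "columns A \<subseteq> range ((*v) A)"
    proof
      fix v assume "v \<in> columns A"
      then obtain j where "v = column j A" by (auto simp: columns_def)
      then have "v = A *v axis j 1"
        by (simp add: vec_eq_iff column_def matrix_vector_mult_def axis_def if_distrib cong: if_cong)
      then show "v \<in> range ((*v) A)" by blast
    qed
  qed (auto intro: matrix_vector_mult_in_columnspace_gen subspace_image_mv)
  ultimately show ?thesis
    by (metis row_rank_def_gen vec.dim_span)
qed

lemma rank_ker:
  fixes A :: "'a::field^'n^'m"
  shows "rank A + vec.dim {x. A *v x = 0} = CARD('n)"
  using dim_image_ker[OF vec.subspace_UNIV, of A] rank_dim_range_field[of A]
    vec_dim_card[where 'a='a and 'n='n] by simp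

lemma rank_le_rows: "rank A \<le> CARD('m)" for A :: "'a::field^'n^'m"
  using rank_dim_range_field[of A] vec.dim_subset[of "range ((*v) A)" UNIV]
    vec_dim_card[where 'a='a and 'n='m] by simp

lemma projection_exists:
  fixes U :: "('a::field^'n) set"
  assumes "vec.subspace U"
  obtains E :: "'a^'n^'n" where "\<And>x. E *v x \<in> U" "\<And>x. x \<in> U \<Longrightarrow> E *v x = x"
proof -
  have "Vector_Spaces.linear (*s) (*s) (\<lambda>x::'a^'n. x)"
    using vec.linear_ident by blast
  then obtain g where g: "g ` UNIV \<subseteq> U" "Vector_Spaces.linear (*s) (*s) g" "\<forall>v\<in>U. g v = v"
    using vec.linear_exists_left_inverse_on[of "\<lambda>x. x" U] assms by (auto simp: inj_on_def)
  show thesis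
    using that[of "matrix g"] g matrix_works[OF g(2)] by auto
qed

text \<open>Plays the part of the quotient map modulo \<open>U\<close>. A square matrix keeps the
  quotient in the same type, so that peeling can be an induction.\<close>

lemma annihilator_exists:
  fixes U :: "('a::field^'n) set"
  assumes "vec.subspace U"
  obtains Q :: "'a^'n^'n" where "\<And>x. Q *v x = 0 \<longleftrightarrow> x \<in> U" "\<And>x. x - Q *v x \<in> U"
proof -
  obtain E :: "'a^'n^'n" where E: "\<And>x. E *v x \<in> U" "\<And>x. x \<in> U \<Longrightarrow> E *v x = x"
    using projection_exists[OF assms] by blast
  have *: "(mat 1 - E) *v x = x - E *v x" for x
    by (simp add: matrix_vector_mult_diff_rdistrib)
  show thesis
  proof (rule that[of "mat 1 - E"])
    show "((mat 1 - E) *v x = 0) = (x \<in> U)" for x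
      using E by (auto simp: *) (metis)
    show "x - (mat 1 - E) *v x \<in> U" for x
      using E by (simp add: *)
  qed
qed

lemma dim_ker_image:
  fixes Q :: "'a::field^'m^'k"
  assumes "\<And>x. Q *v x = 0 \<longleftrightarrow> x \<in> R" "vec.subspace V" "R \<subseteq> V"
  shows "vec.dim ((*v) Q ` V) + vec.dim R = vec.dim V"
proof -
  have "{x\<in>V. Q *v x = 0} = R" using assms by auto
  then show ?thesis using dim_image_ker[OF assms(2), of Q] by simp
qed

lemma subspace_in_hyperplane:
  fixes U :: "('a::field^'n) set"
  assumes "vec.subspace U" "U \<noteq> UNIV"
  obtains H where "vec.subspace H" "U \<subseteq> H" "vec.dim H = CARD('n) - 1" "H \<noteq> UNIV"
proof -
  obtain v where v: "v \<notin> U" using assms by auto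
  then have v0: "v \<noteq> 0" using assms(1) vec.subspace_0 by blast
  have "vec.span {v} \<inter> U = {0}"
  proof -
    have "x = 0" if x: "x \<in> vec.span {v}" "x \<in> U" for x
    proof -
      obtain k where k: "x = k *s v" using x vec.span_singleton by auto
      show ?thesis
      proof (rule ccontr)
        assume "x \<noteq> 0"
        then have "v = inverse k *s x" using k by auto
        then show False using v x vec.subspace_scale[OF assms(1)] by metis
      qed
    qed
    then show ?thesis using vec.span_zero vec.subspace_0[OF assms(1)] by auto
  qed
  then obtain H where H: "vec.subspace H" "U \<subseteq> H" "vec.span {v} \<inter> H = {0}"
     "vec.dim H + vec.dim (vec.span {v}) = CARD('n)"
    using complement_exists[OF vec.subspace_span assms(1)] by metis
  have "v \<notin> H" using H(3) v0 vec.span_base by blast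
  moreover have "vec.dim (vec.span {v}) = 1"
    using v0 by (simp add: vec.dim_singleton)
  moreover have "H \<noteq> UNIV" using \<open>v \<notin> H\<close> by auto
  ultimately show thesis using that[of H] H by (metis diff_add_inverse2)
qed

section \<open>Spaces of matrices of bounded rank\<close>

definition mscale :: "'a::field \<Rightarrow> 'a^'n^'m \<Rightarrow> 'a^'n^'m" where
  "mscale c A = (\<chi> i j. c * A $ i $ j)"

lemma mscale_mv [simp]: "mscale c A *v x = c *s (A *v x)"
  by (simp add: mscale_def matrix_vector_mult_def vec_eq_iff sum_distrib_left mult.assoc)

lemma add_mv [simp]: "(A + B) *v x = A *v x + B *v x" for A :: "'a::field^'n^'m"
  by (rule matrix_vector_mult_add_rdistrib)

lemma diff_mv [simp]: "(A - B) *v x = A *v x - B *v x" for A :: "'a::field^'n^'m"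
  by (rule matrix_vector_mult_diff_rdistrib)

lemma mv_add [simp]: "A *v (x + y) = A *v x + A *v y" for A :: "'a::field^'n^'m"
  by (rule matrix_vector_right_distrib)

lemma mv_diff [simp]: "A *v (x - y) = A *v x - A *v y" for A :: "'a::field^'n^'m"
  by (rule vec.diff)

lemma mv_scale [simp]: "A *v (c *s x) = c *s (A *v x)" for A :: "'a::field^'n^'m"
  by (rule vec.scale)

lemma mv_zero [simp]: "A *v 0 = 0" for A :: "'a::field^'n^'m"
  by (rule vec.zero)

lemma mv_minus [simp]: "A *v (- x) = - (A *v x)" for A :: "'a::field^'n^'m"
  by (rule vec.neg)

lemma mm_mv [simp]: "(A ** B) *v x = A *v (B *v x)" for A :: "'a::field^'n^'m"
  by (simp add: matrix_vector_mul_assoc)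

lemma rank_le_of_ker:
  fixes A :: "'a::field^'n^'m" and B :: "'a^'n^'k"
  assumes "\<And>x. A *v x = 0 \<Longrightarrow> B *v x = 0"
  shows "rank B \<le> rank A"
proof -
  have "vec.dim {x. A *v x = 0} \<le> vec.dim {x. B *v x = 0}"
    using assms by (intro vec.dim_subset) auto
  then show ?thesis using rank_ker[of A] rank_ker[of B] by linarith
qed

lemma rank_less_of_ker:
  fixes A :: "'a::field^'n^'m" and B :: "'a^'n^'k"
  assumes "\<And>x. A *v x = 0 \<Longrightarrow> B *v x = 0" "B *v z = 0" "A *v z \<noteq> 0"
  shows "rank B < rank A"
proof -
  have "{x. A *v x = 0} \<noteq> {x. B *v x = 0}" using assms(2,3) by auto
  then have "\<not> vec.dim {x. B *v x = 0} \<le> vec.dim {x. A *v x = 0}"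
    using vec.subspace_dim_equal[OF subspace_ker[of A] subspace_ker[of B]] assms(1) by blast
  then show ?thesis using rank_ker[of A] rank_ker[of B] by linarith
qed

lemma matrix_eqI: "(\<And>x. A *v x = B *v x) \<Longrightarrow> A = B" for A :: "'a::field^'n^'m"
  by (simp add: matrix_eq)

lemma mm_mscale: "Q ** mscale c A = mscale c (Q ** A)"
  by (rule matrix_eqI) simp

lemma mscale_mm: "mscale c A ** Q = mscale c (A ** Q)"
  by (rule matrix_eqI) simp

lemma mm_add: "Q ** (A + B) = Q ** A + Q ** B" for A B :: "'a::field^'n^'m"
  by (rule matrix_eqI) simp

lemma add_mm: "(A + B) ** Q = A ** Q + B ** Q" for A B :: "'a::field^'n^'m"
  by (rule matrix_eqI) simp

lemma ms_zero: "matrix_subspace S \<Longrightarrow> 0 \<in> S"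
  by (simp add: matrix_subspace_def)

lemma ms_add: "matrix_subspace S \<Longrightarrow> A \<in> S \<Longrightarrow> B \<in> S \<Longrightarrow> A + B \<in> S"
  by (simp add: matrix_subspace_def)

lemma ms_scale: "matrix_subspace S \<Longrightarrow> A \<in> S \<Longrightarrow> mscale c A \<in> S"
  by (simp add: matrix_subspace_def mscale_def)

lemma ms_diff:
  assumes "matrix_subspace S" "A \<in> S" "B \<in> S"
  shows "A - B \<in> S"
proof -
  have "A - B = A + mscale (- 1) B"
    by (rule matrix_eqI) (simp add: vec_eq_iff)
  then show ?thesis using assms ms_add ms_scale by metis
qed

section \<open>Evaluation spaces and column spaces\<close>

definition ev :: "('a::field^'n^'m) set \<Rightarrow> 'a^'n \<Rightarrow> ('a^'m) set" where
  "ev S x = {M *v x | M. M \<in> S}"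

lemma evI: "M \<in> S \<Longrightarrow> M *v x \<in> ev S x"
  by (auto simp: ev_def)

lemma subspace_ev:
  fixes S :: "('a::field^'n^'m) set"
  assumes "matrix_subspace S"
  shows "vec.subspace (ev S x)"
proof (rule vec.subspaceI)
  show "0 \<in> ev S x" using evI[OF ms_zero[OF assms], of x] by simp
  show "a + b \<in> ev S x" if ab: "a \<in> ev S x" "b \<in> ev S x" for a b
  proof -
    obtain A B where "A \<in> S" "B \<in> S" "a = A *v x" "b = B *v x" using ab by (auto simp: ev_def)
    then show ?thesis using evI[OF ms_add[OF assms, of A B], of x] by simp
  qed
  show "c *s a \<in> ev S x" if a: "a \<in> ev S x" for c a
  proof -
    obtain A where "A \<in> S" "a = A *v x" using a by (auto simp: ev_def)
    then show ?thesis using evI[OF ms_scale[OF assms, of A c], of x] by simp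
  qed
qed

definition img :: "('a::field^'n^'m) set \<Rightarrow> ('a^'m) set" where
  "img S = vec.span (\<Union>x. ev S x)"

definition lmul :: "'a::field^'m^'k \<Rightarrow> ('a^'n^'m) set \<Rightarrow> ('a^'n^'k) set" where
  "lmul Q S = (\<lambda>M. Q ** M) ` S"

definition rmul :: "('a::field^'n^'m) set \<Rightarrow> 'a^'k^'n \<Rightarrow> ('a^'k^'m) set" where
  "rmul S E = (\<lambda>M. M ** E) ` S"

lemma lmulI: "M \<in> S \<Longrightarrow> Q ** M \<in> lmul Q S"
  by (simp add: lmul_def)

lemma rmulI: "M \<in> S \<Longrightarrow> M ** E \<in> rmul S E"
  by (simp add: rmul_def)

lemma matrix_subspace_lmul: 
  assumes "matrix_subspace S"
  shows "matrix_subspace (lmul Q S)"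
proof -
  have "(\<chi> i j. c * (Q ** A) $ i $ j) \<in> lmul Q S" if "A \<in> S" for c A
    using lmulI[OF ms_scale[OF assms that, of c], of Q] by (simp add: mm_mscale) (simp add: mscale_def)
  moreover have "Q ** A + Q ** B \<in> lmul Q S" if "A \<in> S" "B \<in> S" for A B
    using lmulI[OF ms_add[OF assms that], of Q] by (simp add: mm_add)
  moreover have "0 \<in> lmul Q S"
    using lmulI[OF ms_zero[OF assms], of Q] by (metis lmulI matrix_eqI mm_mv mv_zero matrix_vector_mult_0)
  ultimately show ?thesis
    unfolding matrix_subspace_def by (auto simp: lmul_def)
qed

lemma matrix_subspace_rmul: 
  assumes "matrix_subspace S"
  shows "matrix_subspace (rmul S E)"
proof -
  have "(\<chi> i j. c * (A ** E) $ i $ j) \<in> rmul S E" if "A \<in> S" for c A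
    using rmulI[OF ms_scale[OF assms that, of c], of E] by (simp add: mscale_mm) (simp add: mscale_def)
  moreover have "A ** E + B ** E \<in> rmul S E" if "A \<in> S" "B \<in> S" for A B
    using rmulI[OF ms_add[OF assms that], of E] by (simp add: add_mm)
  moreover have "0 \<in> rmul S E"
    using rmulI[OF ms_zero[OF assms], of E] by (metis matrix_eqI mm_mv matrix_vector_mult_0)
  ultimately show ?thesis
    unfolding matrix_subspace_def by (auto simp: rmul_def)
qed

lemma ev_lmul: "ev (lmul Q S) x = (*v) Q ` ev S x"
  by (force simp: ev_def lmul_def)

lemma ev_rmul: "ev (rmul S E) x = ev S (E *v x)"
  by (force simp: ev_def rmul_def)

lemma img_lmul: "img (lmul Q S) = (*v) Q ` img S"
proof -
  have "(\<Union>x. ev (lmul Q S) x) = (*v) Q ` (\<Union>x. ev S x)"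
    by (auto simp: ev_lmul)
  then show ?thesis
    unfolding img_def by (simp add: vec.span_image)
qed

lemma ev_sub_img: "ev S x \<subseteq> img S"
  by (auto simp: img_def intro: vec.span_base)

lemma subspace_img: "vec.subspace (img S)"
  by (simp add: img_def)

lemma dim_img_lmul:
  assumes "matrix_subspace S" "\<And>y. Q *v y = 0 \<longleftrightarrow> y \<in> ev S z"
  shows "vec.dim (img (lmul Q S)) + vec.dim (ev S z) = vec.dim (img S)"
  unfolding img_lmul by (rule dim_ker_image[OF assms(2) subspace_img ev_sub_img])

text \<open>\<open>card\<close> gives 0 on infinite sets, hence the separate disjunct.\<close>

definition exceeds :: "'a set \<Rightarrow> nat \<Rightarrow> bool" where
  "exceeds K r \<longleftrightarrow> infinite K \<or> r < card K"

lemma exceeds_obtain: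
  assumes "exceeds K r" "finite B" "card B \<le> r"
  obtains t where "t \<in> K" "t \<notin> B"
  using assms unfolding exceeds_def
  by (metis card_mono finite_subset linorder_not_less order.trans subsetI)

lemma exceeds_mono: "exceeds K r \<Longrightarrow> s \<le> r \<Longrightarrow> exceeds K s"
  by (auto simp: exceeds_def)

section \<open>Rank drops along a pencil M + tP\<close>

lemma card_eigenvalues_le:
  fixes F :: "'a::field^'n^'n"
  assumes "finite L" "\<And>t. t \<in> L \<Longrightarrow> v t \<noteq> 0" "\<And>t. t \<in> L \<Longrightarrow> F *v v t = t *s v t"
    and "\<And>t. t \<in> L \<Longrightarrow> v t \<in> W"
  shows "card L \<le> vec.dim W"
proof -
  have "(\<Sum>t\<in>L. a t *s v t) = 0 \<Longrightarrow> \<forall>t\<in>L. a t = 0" for a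
    using assms(1-3)
  proof (induction L arbitrary: a rule: finite_induct)
    case (insert s L)
    have e1: "a s *s v s + (\<Sum>t\<in>L. a t *s v t) = 0"
      using insert.prems(1) insert.hyps by simp
    have "F *v (a s *s v s + (\<Sum>t\<in>L. a t *s v t)) = (a s * s) *s v s + (\<Sum>t\<in>L. (a t * t) *s v t)"
      using insert.prems(3) by (simp add: vec.sum vector_smult_assoc)
    then have e2: "(a s * s) *s v s + (\<Sum>t\<in>L. (a t * t) *s v t) = 0"
      using e1 by simp
    have "s *s (a s *s v s + (\<Sum>t\<in>L. a t *s v t)) = (a s * s) *s v s + (\<Sum>t\<in>L. (a t * s) *s v t)"
      by (simp add: vector_add_ldistrib vec.scale_sum_right vector_smult_assoc mult.commute)
    then have e3: "(a s * s) *s v s + (\<Sum>t\<in>L. (a t * s) *s v t) = 0"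
      using e1 by simp
    \<comment> \<open>Applying \<open>F\<close> to the relation and multiplying it by
      \<open>s\<close> agree on the term of \<open>v s\<close>, so the difference eliminates
      it.\<close>
    have "(\<Sum>t\<in>L. (a t * (t - s)) *s v t) = (\<Sum>t\<in>L. (a t * t) *s v t) - (\<Sum>t\<in>L. (a t * s) *s v t)"
      by (simp add: vec.scale_left_diff_distrib right_diff_distrib sum_subtractf)
    also have "\<dots> = 0"
      using e2 e3 by (simp add: add_eq_0_iff)
    finally have "\<forall>t\<in>L. a t * (t - s) = 0"
      using insert.IH[of "\<lambda>t. a t * (t - s)"] insert.prems by simp
    then have aL: "\<forall>t\<in>L. a t = 0"
      using insert.hyps(2) by auto
    then have "(\<Sum>t\<in>L. a t *s v t) = 0"
      by (intro sum.neutral) simp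
    then have "a s *s v s = 0" using e1 by simp
    then have "a s = 0" using insert.prems(2) by (simp add: vec.scale_eq_0_iff)
    then show ?case using aL by simp
  qed simp
  note lin = this
  have inj: "inj_on v L"
  proof (rule inj_onI)
    fix s t assume st: "s \<in> L" "t \<in> L" "v s = v t"
    then have "s *s v s = t *s v s" using assms(3) by metis
    then show "s = t" using assms(2)[OF st(1)] by (simp add: vec.scale_right_imp_eq)
  qed
  have "vec.independent (v ` L)"
  proof (rule vec.independent_if_scalars_zero)
    fix f x assume "(\<Sum>x\<in>v ` L. f x *s x) = 0" and x: "x \<in> v ` L"
    then have "(\<Sum>t\<in>L. f (v t) *s v t) = 0"
      by (simp add: sum.reindex[OF inj])
    then show "f x = 0" using lin[of "\<lambda>t. f (v t)"] x by auto
  qed (simp add: assms)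
  then have "card (v ` L) \<le> vec.dim W"
    using assms(4) by (intro vec.independent_card_le_dim) auto
  then show ?thesis using card_image[OF inj] by simp
qed

text \<open>On a complement \<open>U\<close> of the kernel of \<open>P\<close> there is a left
  inverse \<open>G\<close> of \<open>P\<close>. A drop at \<open>t\<close> makes M + tP kill a
  nonzero \<open>u\<close> in \<open>U\<close>, which is then an eigenvector of - GM for the
  eigenvalue \<open>t\<close>. Eigenvectors in \<open>U\<close> admit at most dim U = rank P
  eigenvalues.\<close>

lemma card_rank_drop_le:
  fixes M P :: "'a::field^'n^'m"
  shows "finite {t. rank (M + mscale t P) < rank P}" (is "finite ?B")
    and "card {t. rank (M + mscale t P) < rank P} \<le> rank P"
proof -
  obtain U where U: "vec.subspace U" "{x. P *v x = 0} \<inter> U = {0}"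
      "vec.dim U + vec.dim {x. P *v x = 0} = CARD('n)"
    using complement_exists[OF subspace_ker[of P] vec.subspace_single_0]
      vec.subspace_0[OF subspace_ker[of P]] by (metis Int_insert_right_if1 Int_empty_right)
  have dU: "vec.dim U = rank P"
    using U(3) rank_ker[of P] by simp
  have "inj_on ((*v) P) U"
    using U(2) vec.inj_on_iff_eq_0[of U P] U(1) by auto
  then obtain g where g: "Vector_Spaces.linear (*s) (*s) g" "\<forall>v\<in>U. g (P *v v) = v"
    using vec.linear_exists_left_inverse_on[of "(*v) P" U] U(1) by auto
  define G where "G = matrix g"
  have G: "G *v (P *v u) = u" if "u \<in> U" for u
    using matrix_works[OF g(1)] g(2) that by (simp add: G_def)
  have "\<exists>u\<in>U. u \<noteq> 0 \<and> (M + mscale t P) *v u = 0" if t: "t \<in> ?B" for t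
  proof (rule ccontr)
    assume "\<not> ?thesis"
    then have "{x\<in>U. (M + mscale t P) *v x = 0} \<subseteq> {0}" by auto
    then have "vec.dim {x\<in>U. (M + mscale t P) *v x = 0} = 0"
      by (simp only: vec.dim_eq_0)
    then have "vec.dim ((*v) (M + mscale t P) ` U) = rank P"
      using dim_image_ker[OF U(1), of "M + mscale t P"] dU by linarith
    moreover have "vec.dim ((*v) (M + mscale t P) ` U) \<le> rank (M + mscale t P)"
      unfolding rank_dim_range_field by (intro vec.dim_subset) auto
    ultimately show False using t by simp
  qed
  then obtain u where u: "\<And>t. t \<in> ?B \<Longrightarrow> u t \<in> U \<and> u t \<noteq> 0 \<and> (M + mscale t P) *v u t = 0"
    by metis
  have eig: "(- (G ** M)) *v u t = t *s u t" if "t \<in> ?B" for t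
  proof -
    have "M *v u t + t *s (P *v u t) = 0" using u[OF that] by simp
    then have "G *v (M *v u t + t *s (P *v u t)) = 0" by simp
    then have "G *v (M *v u t) = - (t *s u t)"
      using G u[OF that] by (simp add: eq_neg_iff_add_eq_0)
    then show ?thesis
      using diff_mv[of 0 "G ** M" "u t"] by simp
  qed
  have le: "card L \<le> rank P" if "finite L" "L \<subseteq> ?B" for L
  proof -
    have "card L \<le> vec.dim U"
      by (rule card_eigenvalues_le[of L u "- (G ** M)" U]) (use that eig u in auto)
    then show ?thesis using dU by simp
  qed
  then show "finite ?B"
    using finite_if_finite_subsets_card_bdd[of ?B "rank P"] by blast
  with le show "card ?B \<le> rank P" by blast
qed

section \<open>Consequences of maximal rank\<close>

definition bounded_rank :: "('a::field^'n^'m) set \<Rightarrow> nat \<Rightarrow> bool" where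
  "bounded_rank S r \<longleftrightarrow> matrix_subspace S \<and> (\<forall>M\<in>S. rank M \<le> r) \<and> exceeds (UNIV :: 'a set) r"

lemma bounded_rank_ms: "bounded_rank S r \<Longrightarrow> matrix_subspace S"
  by (simp add: bounded_rank_def)

text \<open>Source of all block identities. If \<open>v\<close> were outside the image of
  \<open>P\<close>, divide by Z = D + Kv. The image of \<open>P\<close> meets Z only in
  \<open>D\<close>, so it loses dim D, and for a suitable \<open>t\<close> the quotient of M + tP
  has at least the same rank. But the image of M + tP contains Z and loses dim D + 1.\<close>

lemma no_extra_direction:
  fixes M P :: "'a::field^'n^'m"
  assumes S: "bounded_rank S (rank P)" "P \<in> S" "M \<in> S"
    and D: "vec.subspace D" "D \<subseteq> range ((*v) P)"
    and Dt: "\<And>t. D \<subseteq> range ((*v) (M + mscale t P))"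
    and vt: "\<And>t. v \<in> range ((*v) (M + mscale t P))"
  shows "v \<in> range ((*v) P)"
proof (rule ccontr)
  assume v: "v \<notin> range ((*v) P)"
  let ?Z = "vec.span (insert v D)"
  have sub: "vec.subspace (range ((*v) A))" for A :: "'a^'n^'m"
    using subspace_image_mv[OF vec.subspace_UNIV] .
  have spD: "vec.span D = D" using D by simp
  have ZP: "y \<in> D" if y: "y \<in> range ((*v) P)" "y \<in> ?Z" for y
  proof -
    obtain k where k: "y - k *s v \<in> D"
      using y(2) vec.span_breakdown_eq spD by metis
    have "k = 0"
    proof (rule ccontr)
      assume k0: "k \<noteq> 0"
      have "y - (y - k *s v) \<in> range ((*v) P)"
        using vec.subspace_diff[OF sub y(1)] k D by blast
      then have "inverse k *s (k *s v) \<in> range ((*v) P)"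
        using vec.subspace_scale[OF sub] by (metis add_diff_cancel diff_add_cancel minus_diff_eq uminus_add_conv_diff)
      then show False using v k0 by simp
    qed
    then show ?thesis using k by simp
  qed
  have dZ: "vec.dim ?Z = vec.dim D + 1"
  proof -
    have "v \<notin> vec.span D" using v D spD by blast
    then show ?thesis by (simp add: vec.dim_insert)
  qed
  obtain Q :: "'a^'m^'m" where Q: "\<And>x. Q *v x = 0 \<longleftrightarrow> x \<in> ?Z"
    using annihilator_exists[OF vec.subspace_span] by metis
  have im: "range ((*v) (Q ** A)) = (*v) Q ` range ((*v) A)" for A :: "'a^'n^'m"
    by (auto simp: image_image)
  have "{y\<in>range ((*v) P). Q *v y = 0} = D"
    using Q ZP D vec.span_base[of _ "insert v D"] by auto
  then have rQP: "rank (Q ** P) + vec.dim D = rank P"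
    using dim_image_ker[OF sub, of Q P] by (simp add: rank_dim_range_field im del: mm_mv)
  then have "exceeds (UNIV :: 'a set) (rank (Q ** P))"
    using S exceeds_mono[of "UNIV :: 'a set" "rank P" "rank (Q ** P)"] by (simp add: bounded_rank_def)
  then obtain t where "t \<notin> {t. rank (Q ** M + mscale t (Q ** P)) < rank (Q ** P)}"
    using exceeds_obtain card_rank_drop_le by metis
  then have t: "rank (Q ** (M + mscale t P)) \<ge> rank (Q ** P)"
    by (simp add: mm_add mm_mscale)
  have "?Z \<subseteq> range ((*v) (M + mscale t P))"
    using Dt vt by (intro vec.span_minimal sub) auto
  then have "rank (Q ** (M + mscale t P)) + vec.dim ?Z = rank (M + mscale t P)"
    using dim_ker_image[OF Q sub] by (simp add: rank_dim_range_field im del: mm_mv add_mv)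
  moreover have "rank (M + mscale t P) \<le> rank P"
    using S ms_add ms_scale unfolding bounded_rank_def by blast
  ultimately show False using t rQP dZ by simp
qed

lemma range_pencil:
  fixes M P :: "'a::field^'n^'m"
  shows "M *v y + t *s (P *v y) \<in> range ((*v) (M + mscale t P))"
  by (metis add_mv mscale_mv rangeI)

text \<open>M + tP sends \<open>z\<close> to Mz for every \<open>t\<close>. This is the vanishing of
  the lower right block.\<close>

lemma maximal_rank_range:
  fixes P :: "'a::field^'n^'m"
  assumes "bounded_rank S (rank P)" "P \<in> S" "M \<in> S" and z: "P *v z = 0"
  shows "M *v z \<in> range ((*v) P)"
proof (rule no_extra_direction[OF assms(1-3) vec.subspace_single_0])
  fix t show "M *v z \<in> range ((*v) (M + mscale t P))"
    using range_pencil[of M z t P] z by simp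
next
  show "{0} \<subseteq> range ((*v) A)" for A :: "'a^'n^'m"
    using mv_zero[of A] by (metis empty_subsetI insert_subset rangeI)
  show "{0} \<subseteq> range ((*v) A)" for A :: "'a^'n^'m" by fact
qed

text \<open>Py = Mz lies in every image, so subtracting tPy from (M + tP)y leaves My there. With y =
  GMz this becomes BC = 0.\<close>

lemma maximal_rank_range2:
  fixes P :: "'a::field^'n^'m"
  assumes S: "bounded_rank S (rank P)" "P \<in> S" "M \<in> S" and z: "P *v z = 0" "P *v y = M *v z"
  shows "M *v y \<in> range ((*v) P)"
proof (rule no_extra_direction[OF S, of "vec.span {P *v y}"])
  have sub: "vec.subspace (range ((*v) A))" for A :: "'a^'n^'m"
    using subspace_image_mv[OF vec.subspace_UNIV] .
  show "vec.span {P *v y} \<subseteq> range ((*v) P)"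
    by (intro vec.span_minimal sub) auto
  have Py: "P *v y \<in> range ((*v) (M + mscale t P))" for t
    using range_pencil[of M z t P] z by simp
  then show "vec.span {P *v y} \<subseteq> range ((*v) (M + mscale t P))" for t
    by (intro vec.span_minimal sub) auto
  show "M *v y \<in> range ((*v) (M + mscale t P))" for t
    using vec.subspace_diff[OF sub range_pencil[of M y t P] vec.subspace_scale[OF sub Py[of t], of t]]
    by simp
qed simp

text \<open>One more round of the same subtraction, with Px joining \<open>D\<close>; this becomes
  BAC = 0.\<close>

lemma maximal_rank_range3:
  fixes P :: "'a::field^'n^'m"
  assumes S: "bounded_rank S (rank P)" "P \<in> S" "M \<in> S"
    and z: "P *v z = 0" "P *v y = M *v z" "P *v x = M *v y"
  shows "M *v x \<in> range ((*v) P)"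
proof (rule no_extra_direction[OF S, of "vec.span {P *v y, P *v x}"])
  have sub: "vec.subspace (range ((*v) A))" for A :: "'a^'n^'m"
    using subspace_image_mv[OF vec.subspace_UNIV] .
  show "vec.span {P *v y, P *v x} \<subseteq> range ((*v) P)"
    by (intro vec.span_minimal sub) auto
  have Py: "P *v y \<in> range ((*v) (M + mscale t P))" for t
    using range_pencil[of M z t P] z by simp
  have Px: "P *v x \<in> range ((*v) (M + mscale t P))" for t
    using vec.subspace_diff[OF sub range_pencil[of M y t P] vec.subspace_scale[OF sub Py[of t], of t]] z
    by simp
  show "vec.span {P *v y, P *v x} \<subseteq> range ((*v) (M + mscale t P))" for t
    using Px Py by (intro vec.span_minimal sub) auto
  show "M *v x \<in> range ((*v) (M + mscale t P))" for t
    using vec.subspace_diff[OF sub range_pencil[of M x t P] vec.subspace_scale[OF sub Px[of t], of t]]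
    by simp
qed simp

text \<open>A matrix not killing \<open>z\<close> loses rank, since \<open>z\<close> is new in its
  kernel. Were the quotient of some \<open>M\<close> with Mz = 0 still of rank \<open>r\<close>, the
  same would hold for some N + tM, which does not kill \<open>z\<close>.\<close>

lemma bounded_rank_quotient:
  fixes S :: "('a::field^'n^'m) set"
  assumes S: "bounded_rank S r" and N: "N \<in> S" "N *v z \<noteq> 0"
    and Q: "\<And>y. Q *v y = 0 \<longleftrightarrow> y \<in> ev S z"
  shows "bounded_rank (lmul Q S) (r - 1)"
proof -
  have ms: "matrix_subspace S" using S by (rule bounded_rank_ms)
  have A: "rank (Q ** M) < r" if M: "M \<in> S" "M *v z \<noteq> 0" for M
  proof -
    have "rank (Q ** M) < rank M"
    proof (rule rank_less_of_ker[of M "Q ** M" z])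
      show "(Q ** M) *v z = 0" using Q evI[OF M(1), of z] by simp
    qed (use M in simp_all)
    then show ?thesis using S M by (auto simp: bounded_rank_def)
  qed
  have B: "rank (Q ** M) < r" if M: "M \<in> S" for M
  proof (rule ccontr)
    assume nl: "\<not> rank (Q ** M) < r"
    have Mz: "M *v z = 0" using A[OF M] nl by blast
    have "rank (Q ** M) \<le> rank M"
      by (rule rank_le_of_ker) simp
    then have "exceeds (UNIV :: 'a set) (rank (Q ** M))"
      using S M exceeds_mono order_trans unfolding bounded_rank_def by blast
    then obtain t where "t \<notin> {t. rank (Q ** N + mscale t (Q ** M)) < rank (Q ** M)}"
      using exceeds_obtain card_rank_drop_le by metis
    then have "rank (Q ** (N + mscale t M)) \<ge> r"
      using nl by (simp add: mm_add mm_mscale)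
    moreover have "N + mscale t M \<in> S" "(N + mscale t M) *v z \<noteq> 0"
      using ms_add[OF ms N(1) ms_scale[OF ms M]] N(2) Mz by auto
    ultimately show False using A by (meson not_le)
  qed
  show ?thesis
    unfolding bounded_rank_def
    using matrix_subspace_lmul[OF ms] B S exceeds_mono[of "UNIV :: 'a set" r "r - 1"]
    by (fastforce simp: bounded_rank_def lmul_def)
qed

section \<open>The column property\<close>

definition spanned :: "('a::field^'n^'m) set \<Rightarrow> ('a^'n) set \<Rightarrow> ('a^'m) set" where
  "spanned S U = vec.span {N *v u | N u. N \<in> S \<and> u \<in> U}"

text \<open>Coordinate-free form: the quotient maps from \<open>K\<^sup>n/U\<close> to \<open>K\<^sup>m/SU\<close> are never injective
  for proper \<open>U\<close>. It is visibly inherited by all spaces \<open>QS\<close>.\<close>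

definition colprop :: "('a::field^'n^'m) set \<Rightarrow> bool" where
  "colprop S \<longleftrightarrow> (\<forall>U. vec.subspace U \<longrightarrow> U \<noteq> UNIV \<longrightarrow>
     (\<forall>M\<in>S. \<exists>x. x \<notin> U \<and> M *v x \<in> spanned S U))"

lemma colpropD:
  assumes "colprop S" "vec.subspace U" "U \<noteq> UNIV" "M \<in> S"
  obtains x where "x \<notin> U" "M *v x \<in> spanned S U"
  using assms unfolding colprop_def by meson

lemma spanned_lmul: "spanned (lmul Q S) U = (*v) Q ` spanned S U"
proof -
  have "{N *v u | N u. N \<in> lmul Q S \<and> u \<in> U} = (*v) Q ` {N *v u | N u. N \<in> S \<and> u \<in> U}"
    by (force simp: lmul_def)
  then show ?thesis unfolding spanned_def by (simp add: vec.span_image)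
qed

lemma colprop_lmul:
  fixes S :: "('a::field^'n^'m) set" and Q :: "'a^'m^'k"
  assumes "colprop S"
  shows "colprop (lmul Q S)"
  unfolding colprop_def
proof (intro allI impI ballI)
  fix U :: "('a^'n) set" and M
  assume U: "vec.subspace U" "U \<noteq> UNIV" "M \<in> lmul Q S"
  then obtain N where N: "N \<in> S" "M = Q ** N" by (auto simp: lmul_def)
  obtain x where "x \<notin> U" "N *v x \<in> spanned S U"
    using colpropD[OF assms U(1,2) N(1)] .
  then show "\<exists>x. x \<notin> U \<and> M *v x \<in> spanned (lmul Q S) U"
    using N by (auto simp: spanned_lmul)
qed

definition comker :: "('a::field^'n^'m) set \<Rightarrow> ('a^'n) set" where
  "comker S = {x. \<forall>M\<in>S. M *v x = 0}"

lemma subspace_comker: "vec.subspace (comker S)"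
  by (simp add: vec.subspace_def comker_def)

lemma spanned_zero:
  assumes "U \<subseteq> comker S"
  shows "spanned S U \<subseteq> {0}"
  unfolding spanned_def
  by (rule vec.span_minimal) (use assms in \<open>auto simp: comker_def\<close>)

text \<open>The column property for the common kernel; it supplies the vector along which to
  peel.\<close>

lemma colprop_ker:
  assumes "colprop S" "comker S \<noteq> UNIV" "M \<in> S"
  obtains x where "M *v x = 0" "x \<notin> comker S"
  using colpropD[OF assms(1) subspace_comker assms(2,3)] spanned_zero[of "comker S" S] by blast

lemma dim_img_comker:
  assumes "comker S = UNIV"
  shows "vec.dim (img S) = 0"
proof -
  have "ev S x \<subseteq> {0}" for x
    using assms by (auto simp: ev_def comker_def)
  then have "img S \<subseteq> {0}"
    unfolding img_def by (intro vec.span_minimal) auto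
  then show ?thesis by (simp only: vec.dim_eq_0)
qed

lemma max_rank_obtain:
  assumes "matrix_subspace S"
  obtains P where "P \<in> S" "\<And>M. M \<in> S \<Longrightarrow> rank M \<le> rank (P :: 'a::field^'n^'m)"
  using ex_has_greatest_nat[of "\<lambda>M. M \<in> S" 0 rank "Suc CARD('m)"] ms_zero[OF assms]
    rank_le_rows[where 'a='a and 'n='n and 'm='m] by (metis less_Suc_eq_le)

lemma rank_zero_field: "rank (0 :: 'a::field^'n^'m) = 0"
proof -
  have "range ((*v) (0 :: 'a^'n^'m)) \<subseteq> {0}" by auto
  then show ?thesis by (simp only: rank_dim_range_field vec.dim_eq_0)
qed

lemma rank_pos:
  assumes "N *v x \<noteq> 0"
  shows "0 < rank (N :: 'a::field^'n^'m)"
  using rank_less_of_ker[of N "0 :: 'a^'n^'m" x] assms rank_zero_field by simp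

lemma choose_two_Suc: "Suc r choose 2 = (r choose 2) + r"
  by (simp add: numeral_2_eq_2)

lemma dim_ev_le_rank:
  fixes P :: "'a::field^'n^'m"
  assumes "bounded_rank S (rank P)" "P \<in> S" "P *v z = 0"
  shows "vec.dim (ev S z) \<le> rank P"
  unfolding rank_dim_range_field
  using maximal_rank_range[OF assms(1,2) _ assms(3)]
  by (intro vec.dim_subset) (auto simp: ev_def)

lemma colprop_dim_img_le:
  fixes S :: "('a::field^'n^'m) set"
  assumes "bounded_rank S r" "colprop S"
  shows "vec.dim (img S) \<le> Suc r choose 2"
  using assms
proof (induction r arbitrary: S rule: less_induct)
  case (less r)
  have ms: "matrix_subspace S" using less.prems bounded_rank_ms by blast
  show ?case
  proof (cases "comker S = UNIV")
    case True
    then show ?thesis using dim_img_comker[OF True] by linarith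
  next
    case False
    obtain P where P: "P \<in> S" "\<And>M. M \<in> S \<Longrightarrow> rank M \<le> rank P"
      using max_rank_obtain[OF ms] by metis
    have Pr: "rank P \<le> r" using less.prems P by (auto simp: bounded_rank_def)
    have bP: "bounded_rank S (rank P)"
      using less.prems P(2) exceeds_mono[OF _ Pr] by (auto simp: bounded_rank_def)
    obtain z where z: "P *v z = 0" "z \<notin> comker S"
      using colprop_ker[OF less.prems(2) False P(1)] .
    then obtain N where N: "N \<in> S" "N *v z \<noteq> 0" by (auto simp: comker_def)
    have r0: "0 < r" using rank_pos[OF N(2)] N(1) less.prems(1) by (fastforce simp: bounded_rank_def)
    obtain Q :: "'a^'m^'m" where Q: "\<And>y. Q *v y = 0 \<longleftrightarrow> y \<in> ev S z"
      using annihilator_exists[OF subspace_ev[OF ms]] by metis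
    have "vec.dim (img (lmul Q S)) \<le> Suc (r - 1) choose 2"
      using less.IH[of "r - 1" "lmul Q S"] r0 bounded_rank_quotient[OF less.prems(1) N Q]
        colprop_lmul[OF less.prems(2), of Q] by simp
    moreover have "vec.dim (ev S z) \<le> r"
      using dim_ev_le_rank[OF bP P(1) z(1)] Pr by linarith
    ultimately show ?thesis
      using dim_img_lmul[OF ms Q] r0 choose_two_Suc[of r] by simp
  qed
qed

lemma rank_mul_projection:
  fixes M :: "'a::field^'n^'m" and E :: "'a^'n^'n"
  assumes H: "vec.subspace H" and E: "\<And>x. E *v x \<in> H" "\<And>x. x \<in> H \<Longrightarrow> E *v x = x"
  shows "rank (M ** E) + vec.dim {x\<in>H. M *v x = 0} = vec.dim H"
proof -
  have "range ((*v) E) = H" using E by (metis image_subset_iff rangeI subsetI subset_antisym)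
  then have "range ((*v) (M ** E)) = (*v) M ` H"
    by (metis (no_types, lifting) image_cong image_image mm_mv)
  then show ?thesis
    using dim_image_ker[OF H, of M] by (simp only: rank_dim_range_field)
qed

text \<open>The rank bound concerns the restriction to \<open>H\<close>, encoded by a projection
  \<open>E\<close> onto \<open>H\<close>, while the column property still concerns all of K^n. So
  the vector it supplies need not lie in \<open>H\<close>, and peeling inside \<open>H\<close> can
  get stuck.\<close>

lemma colprop_dim_img_le_hyperplane:
  fixes S :: "('a::field^'n^'m) set" and E :: "'a^'n^'n"
  assumes H: "vec.subspace H" "vec.dim H = CARD('n) - 1"
    and E: "\<And>x. E *v x \<in> H" "\<And>x. x \<in> H \<Longrightarrow> E *v x = x"
    and "matrix_subspace S" "bounded_rank (rmul S E) r" "colprop S"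
  shows "vec.dim (img S) \<le> Suc r choose 2"
  using assms(5-)
proof (induction r arbitrary: S rule: less_induct)
  case (less r)
  note ms = less.prems(1)
  obtain P where P: "P \<in> S" "\<And>M. M \<in> S \<Longrightarrow> rank (M ** E) \<le> rank (P ** E)"
  proof -
    obtain P' where "P' \<in> rmul S E" "\<And>M. M \<in> rmul S E \<Longrightarrow> rank M \<le> rank P'"
      using max_rank_obtain[OF matrix_subspace_rmul[OF ms]] by metis
    then show thesis using that by (auto simp: rmul_def)
  qed
  have Pr: "rank (P ** E) \<le> r" using less.prems(2) P by (auto simp: bounded_rank_def rmul_def)
  have bP: "bounded_rank (rmul S E) (rank (P ** E))"
    using less.prems(2) P(2) exceeds_mono[OF _ Pr] by (auto simp: bounded_rank_def rmul_def)
  show ?case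
  proof (cases "\<exists>z\<in>H. P *v z = 0 \<and> z \<notin> comker S")
    case True
    then obtain z N where z: "z \<in> H" "P *v z = 0" and N: "N \<in> S" "N *v z \<noteq> 0"
      by (auto simp: comker_def)
    have NE: "N ** E \<in> rmul S E" "(N ** E) *v z \<noteq> 0"
      using N E(2)[OF z(1)] by (auto simp: rmul_def)
    have evz: "ev (rmul S E) z = ev S z" using E(2)[OF z(1)] by (simp add: ev_rmul)
    have r0: "0 < r" using rank_pos[OF NE(2)] NE(1) less.prems(2) by (fastforce simp: bounded_rank_def)
    obtain Q :: "'a^'m^'m" where Q: "\<And>y. Q *v y = 0 \<longleftrightarrow> y \<in> ev S z"
      using annihilator_exists[OF subspace_ev[OF ms]] by metis
    have "rmul (lmul Q S) E = lmul Q (rmul S E)"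
      by (auto simp: rmul_def lmul_def image_image matrix_mul_assoc)
    then have "bounded_rank (rmul (lmul Q S) E) (r - 1)"
      using bounded_rank_quotient[OF less.prems(2) NE, of Q] Q evz by simp
    then have "vec.dim (img (lmul Q S)) \<le> Suc (r - 1) choose 2"
      using less.IH[of "r - 1" "lmul Q S"] r0 matrix_subspace_lmul[OF ms, of Q]
        colprop_lmul[OF less.prems(3), of Q] by simp
    moreover have "vec.dim (ev S z) \<le> r"
      using dim_ev_le_rank[OF bP rmulI[OF P(1)], of z] Pr z E(2)[OF z(1)] evz by simp
    ultimately show ?thesis
      using dim_img_lmul[OF ms Q] r0 choose_two_Suc[of r] by simp
  next
    case False
    show ?thesis
    proof (cases "comker S = UNIV")
      case True
      then show ?thesis using dim_img_comker[OF True] by linarith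
    next
      case nz: False
      \<comment> \<open>Stuck: the kernel of \<open>P\<close> in \<open>H\<close> is part of the
        common kernel, so rank (P ** E) >= n - 1 - dim (comker S). The column property makes each
        kernel strictly larger than \<open>comker S\<close>, which makes up for the lost dimension
        and bounds the rank on all of K^n.\<close>
      have "rank M \<le> r" if M: "M \<in> S" for M
      proof -
        obtain x where x: "M *v x = 0" "x \<notin> comker S"
          using colprop_ker[OF less.prems(3) nz M] .
        have "{z\<in>H. P *v z = 0} \<subseteq> comker S" using False by auto
        then have "vec.dim {z\<in>H. P *v z = 0} \<le> vec.dim (comker S)" by (rule vec.dim_subset)
        moreover have "rank (P ** E) + vec.dim {z\<in>H. P *v z = 0} = CARD('n) - 1"
          using rank_mul_projection[OF H(1) E, of P] H(2) by simp
        moreover have "vec.dim (comker S) < vec.dim {x. M *v x = 0}"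
        proof -
          have sub: "comker S \<subseteq> {x. M *v x = 0}" using M by (auto simp: comker_def)
          have "comker S \<noteq> {x. M *v x = 0}" using x by auto
          then show ?thesis
            using vec.subspace_dim_equal[OF subspace_comker subspace_ker sub] by linarith
        qed
        ultimately show ?thesis using rank_ker[of M] Pr by linarith
      qed
      then have "bounded_rank S r"
        using less.prems(2) ms by (auto simp: bounded_rank_def)
      then show ?thesis using colprop_dim_img_le less.prems(3) by blast
    qed
  qed
qed

section \<open>Semi-primitive spaces\<close>

text \<open>The consequence of semi-primitivity used below: the kernels of the matrices of rank
  \<open>r\<close> together span K^n.\<close>

definition kernels_span :: "('a::field^'n^'m) set \<Rightarrow> nat \<Rightarrow> bool" where
  "kernels_span S r \<longleftrightarrow> (\<forall>U. vec.subspace U \<longrightarrow> U \<noteq> UNIV \<longrightarrow>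
     (\<exists>M\<in>S. rank M = r \<and> (\<exists>x. M *v x = 0 \<and> x \<notin> U)))"

lemma rank_lmul_le: "rank (Q ** A) \<le> rank A" for A :: "'a::field^'n^'m"
  by (rule rank_le_of_ker) simp

text \<open>A projection \<open>F\<close> onto a k-dimensional part of the image of \<open>P\<close>
  gives FP rank exactly \<open>k\<close>, so the threshold \<open>k\<close> costs only
  \<open>k\<close> scalars instead of rank P.\<close>

lemma card_rank_less_le:
  fixes M P :: "'a::field^'n^'m"
  assumes "k \<le> rank P"
  shows "finite {t. rank (M + mscale t P) < k}" and "card {t. rank (M + mscale t P) < k} \<le> k"
proof -
  have sub: "vec.subspace (range ((*v) P))"
    using subspace_image_mv[OF vec.subspace_UNIV] .
  obtain T where T: "vec.subspace T" "T \<subseteq> range ((*v) P)" "vec.dim T = k"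
    using vec.choose_subspace_of_subspace[of k "range ((*v) P)"] assms sub
    by (metis rank_dim_range_field vec.span_eq_iff)
  obtain F :: "'a^'m^'m" where F: "\<And>x. F *v x \<in> T" "\<And>x. x \<in> T \<Longrightarrow> F *v x = x"
    using projection_exists[OF T(1)] by metis
  have "range ((*v) (F ** P)) = T"
    using F T(2) by (force simp: image_iff)
  then have rk: "rank (F ** P) = k"
    using T(3) by (simp only: rank_dim_range_field)
  have sub: "{t. rank (M + mscale t P) < k} \<subseteq> {t. rank (F ** M + mscale t (F ** P)) < rank (F ** P)}"
    using rank_lmul_le[of F "M + mscale t P" for t] rk
    by (auto simp: mm_add mm_mscale intro: le_less_trans)
  show "finite {t. rank (M + mscale t P) < k}"
    by (rule finite_subset[OF sub card_rank_drop_le(1)])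
  show "card {t. rank (M + mscale t P) < k} \<le> k"
    using card_mono[OF card_rank_drop_le(1) sub] card_rank_drop_le(2)[of "F ** M" "F ** P"] rk by linarith
qed

lemma rank_split:
  fixes N :: "'a::field^'n^'m"
  assumes "\<And>x. Q *v (N *v (E *v x)) = 0"
  shows "rank (Q ** N) + rank (N ** E) \<le> rank N"
proof -
  have sub: "vec.subspace (range ((*v) N))"
    using subspace_image_mv[OF vec.subspace_UNIV] .
  have "range ((*v) (Q ** N)) = (*v) Q ` range ((*v) N)"
    by (auto simp: image_image)
  then have "rank (Q ** N) + vec.dim {y\<in>range ((*v) N). Q *v y = 0} = rank N"
    using dim_image_ker[OF sub, of Q] by (simp only: rank_dim_range_field)
  moreover have "vec.dim (range ((*v) (N ** E))) \<le> vec.dim {y\<in>range ((*v) N). Q *v y = 0}"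
    using assms by (intro vec.dim_subset) auto
  ultimately show ?thesis by (simp only: rank_dim_range_field)
qed

lemma rank_mscale:
  assumes "u \<noteq> 0"
  shows "rank (mscale u A) = rank (A :: 'a::field^'n^'m)"
  using assms by (intro antisym rank_le_of_ker) (auto simp: vec.scale_eq_0_iff)

text \<open>Let \<open>M\<close> be injective from K^n/U to K^m/SU, with \<open>s\<close> the
  codimension of \<open>U\<close>. Then every restriction to \<open>U\<close> has rank at most r -
  s, since otherwise some N + tM has rank \<open>s\<close> modulo SU and more than r - s on
  \<open>U\<close>. By dimension count the kernel of each matrix of rank \<open>r\<close> lies in
  \<open>U\<close>.\<close>

lemma kernels_span_colprop:
  fixes S :: "('a::field^'n^'m) set"
  assumes S: "bounded_rank S r" and ks: "kernels_span S r"
  shows "colprop S"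
  unfolding colprop_def
proof (intro allI impI ballI, rule ccontr)
  fix U M assume U: "vec.subspace U" "U \<noteq> UNIV" and M: "M \<in> S"
    and "\<not> (\<exists>x. x \<notin> U \<and> M *v x \<in> spanned S U)"
  then have inj: "\<And>x. M *v x \<in> spanned S U \<Longrightarrow> x \<in> U" by blast
  have ms: "matrix_subspace S" using S by (rule bounded_rank_ms)
  define s where "s = CARD('n) - vec.dim U"
  have dU: "vec.dim U + s = CARD('n)"
    using vec.dim_subset[OF subset_UNIV[of U]] vec_dim_card[where 'a='a and 'n='n] by (simp add: s_def)
  have subR: "vec.subspace (spanned S U)" by (simp add: spanned_def)
  obtain Q :: "'a^'m^'m" where Q: "\<And>y. Q *v y = 0 \<longleftrightarrow> y \<in> spanned S U"
    using annihilator_exists[OF subR] by metis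
  obtain E :: "'a^'n^'n" where E: "\<And>x. E *v x \<in> U" "\<And>x. x \<in> U \<Longrightarrow> E *v x = x"
    using projection_exists[OF U(1)] by metis
  have NU: "N *v u \<in> spanned S U" if "N \<in> S" "u \<in> U" for N u
    using that unfolding spanned_def by (intro vec.span_base) blast
  have split: "rank (Q ** N) + rank (N ** E) \<le> rank N" if "N \<in> S" for N
    by (rule rank_split) (use Q NU E that in auto)
  have "{x. (Q ** M) *v x = 0} = U" using inj Q NU[OF M] by auto
  then have rQM: "rank (Q ** M) = s" using rank_ker[of "Q ** M"] dU by simp
  have Mr: "rank M \<le> r" using S M by (auto simp: bounded_rank_def)
  have sr: "s \<le> r" using rank_lmul_le[of Q M] rQM Mr by linarith
  have rME: "rank (M ** E) \<le> r - s" using split[OF M] rQM Mr by linarith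
  have small: "rank (N ** E) \<le> r - s" if N: "N \<in> S" for N
  proof (rule ccontr)
    assume "\<not> rank (N ** E) \<le> r - s"
    then have k: "Suc (r - s) \<le> rank (N ** E)" by simp
    let ?B1 = "{t. rank (Q ** N + mscale t (Q ** M)) < rank (Q ** M)}"
    \<comment> \<open>The second condition is read in u = 1/t. Of its at most r - s + 1 bad values
      one is u = 0, which no \<open>t\<close> produces, so s + (r - s) = r excluded scalars remain,
      and the field has more.\<close>
    let ?B2 = "{u. rank (M ** E + mscale u (N ** E)) < Suc (r - s)}"
    note B1 = card_rank_drop_le[of "Q ** N" "Q ** M"]
    note B2 = card_rank_less_le[OF k, of "M ** E"]
    have "M ** E + mscale 0 (N ** E) = M ** E"
      by (rule matrix_eqI) simp
    then have "0 \<in> ?B2" using rME by simp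
    then have "card (?B2 - {0}) \<le> r - s" using B2 by simp
    then have "card (inverse ` (?B2 - {0})) \<le> r - s"
      using card_image_le[of "?B2 - {0}" inverse] B2(1) by simp
    then have "card (?B1 \<union> inverse ` (?B2 - {0})) \<le> r"
      using card_Un_le[of ?B1 "inverse ` (?B2 - {0})"] B1(2) rQM sr by linarith
    moreover have "finite (?B1 \<union> inverse ` (?B2 - {0}))" using B1(1) B2(1) by simp
    ultimately obtain t where t: "t \<notin> ?B1 \<union> inverse ` (?B2 - {0})"
      using exceeds_obtain[of "UNIV :: 'a set" r] S unfolding bounded_rank_def by metis
    have T: "N + mscale t M \<in> S" using ms N M ms_add ms_scale by blast
    have "s \<le> rank (Q ** (N + mscale t M))"
      using t rQM by (simp add: mm_add mm_mscale)
    moreover have "Suc (r - s) \<le> rank ((N + mscale t M) ** E)"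
    proof (cases "t = 0")
      case True
      then have "(N + mscale t M) ** E = N ** E"
        by (intro matrix_eqI) simp
      then show ?thesis using k by simp
    next
      case False
      then have "inverse t \<notin> ?B2" using t by (force simp: image_iff)
      moreover have "M ** E + mscale (inverse t) (N ** E) = mscale (inverse t) ((N + mscale t M) ** E)"
        using False by (intro matrix_eqI) (simp add: vector_add_ldistrib)
      ultimately show ?thesis
        using rank_mscale[of "inverse t" "(N + mscale t M) ** E"] False by simp
    qed
    moreover have "rank (N + mscale t M) \<le> r" using T S by (auto simp: bounded_rank_def)
    ultimately show False using split[OF T] sr by linarith
  qed
  obtain N x where N: "N \<in> S" "rank N = r" "N *v x = 0" "x \<notin> U"
    using ks U unfolding kernels_span_def by metis
  have "vec.dim {x. N *v x = 0} \<le> vec.dim {x\<in>U. N *v x = 0}"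
    using rank_mul_projection[OF U(1) E, of N] small[OF N(1)] rank_ker[of N] N(2) dU sr by linarith
  moreover have "vec.subspace {x\<in>U. N *v x = 0}"
    using vec.subspace_inter[OF U(1) subspace_ker[of N]] by (simp add: Int_def)
  ultimately have "{x\<in>U. N *v x = 0} = {x. N *v x = 0}"
    using subspace_ker[of N] by (intro vec.subspace_dim_equal) auto
  then show False using N by auto
qed

section \<open>A normal form at a matrix of maximal rank\<close>

lemma dim_Un_le:
  fixes A B :: "('a::field^'n) set"
  shows "vec.dim (A \<union> B) \<le> vec.dim A + vec.dim B"
proof -
  obtain A0 where A0: "vec.independent A0" "A \<subseteq> vec.span A0" "card A0 = vec.dim A"
    using vec.basis_exists[of A] by metis
  obtain B0 where B0: "vec.independent B0" "B \<subseteq> vec.span B0" "card B0 = vec.dim B"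
    using vec.basis_exists[of B] by metis
  have "vec.span A0 \<subseteq> vec.span (A0 \<union> B0)" "vec.span B0 \<subseteq> vec.span (A0 \<union> B0)"
    by (intro vec.span_mono; simp)+
  then have "A \<union> B \<subseteq> vec.span (A0 \<union> B0)" using A0(2) B0(2) by auto
  then have "vec.dim (A \<union> B) \<le> card (A0 \<union> B0)"
    using A0(1) B0(1) by (intro vec.dim_le_card) (auto intro: vec.finiteI_independent)
  then show ?thesis using card_Un_le[of A0 B0] A0(3) B0(3) by linarith
qed

lemma dim_ge_2:
  fixes a b :: "'a::field^'n"
  assumes "a \<noteq> 0" "b \<notin> vec.span {a}" "a \<in> Y" "b \<in> Y"
  shows "2 \<le> vec.dim Y"
proof -
  have "vec.independent {b, a}"
    using assms(1,2) by (intro vec.independent_insertI vec.independent_empty) simp_all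
  moreover have "b \<noteq> a" using assms(2) vec.span_base by blast
  ultimately show ?thesis
    using vec.independent_card_le_dim[of "{b, a}" Y] assms(3,4) by simp
qed

lemma dim_ge_3:
  fixes a b c :: "'a::field^'n"
  assumes "a \<noteq> 0" "b \<notin> vec.span {a}" "c \<notin> vec.span {b, a}" "a \<in> Y" "b \<in> Y" "c \<in> Y"
  shows "3 \<le> vec.dim Y"
proof -
  have "vec.independent {c, b, a}"
    using assms(1-3) by (intro vec.independent_insertI vec.independent_empty) simp_all
  moreover have "b \<noteq> a" using assms(2) vec.span_base by blast
  moreover have "c \<noteq> a" "c \<noteq> b" using assms(3) vec.span_base by blast+
  ultimately show ?thesis
    using vec.independent_card_le_dim[of "{c, b, a}" Y] assms(4-6) by simp
qed

lemma dim_le_1_span: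
  fixes x :: "'a::field^'n"
  assumes "vec.dim Y \<le> 1" "x \<in> Y" "x \<noteq> 0" "y \<in> Y"
  shows "y \<in> vec.span {x}"
  using dim_ge_2[OF assms(3) _ assms(2,4)] assms(1) by linarith

lemma span_singletonE:
  assumes "y \<in> vec.span {x}"
  obtains k where "y = k *s x"
  using assms by (auto simp: vec.span_singleton)

lemma span_pairE:
  assumes "y \<in> vec.span {a, b}"
  obtains k l where "y = k *s a + l *s b"
proof -
  obtain k where "y - k *s a \<in> vec.span {b}"
    using assms vec.span_breakdown_eq by blast
  then obtain l where "y - k *s a = l *s b" by (rule span_singletonE)
  then have "y = k *s a + l *s b" by (simp add: diff_eq_eq add.commute)
  then show thesis by (rule that)
qed

text \<open>A further element \<open>a\<close> creates only the new values \<phi> a c with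
  \<open>c\<close> in \<open>B\<close>. The diagonal condition is separate because of characteristic
  2.\<close>

lemma dim_alternating_le:
  fixes \<phi> :: "'b \<Rightarrow> 'b \<Rightarrow> 'a::field^'m"
  assumes "finite B" "\<And>b c. b \<in> B \<Longrightarrow> c \<in> B \<Longrightarrow> \<phi> b c = - \<phi> c b" "\<And>b. b \<in> B \<Longrightarrow> \<phi> b b = 0"
  shows "vec.dim {\<phi> b c | b c. b \<in> B \<and> c \<in> B} \<le> card B choose 2"
  using assms
proof (induction B rule: finite_induct)
  case empty
  then show ?case by simp
next
  case (insert a B)
  let ?X = "{\<phi> b c | b c. b \<in> B \<and> c \<in> B}" and ?Y = "\<phi> a ` B"
  have "{\<phi> b c | b c. b \<in> insert a B \<and> c \<in> insert a B} \<subseteq> vec.span (?X \<union> ?Y)"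
  proof
    fix v assume "v \<in> {\<phi> b c | b c. b \<in> insert a B \<and> c \<in> insert a B}"
    then obtain b c where v: "v = \<phi> b c" "b \<in> insert a B" "c \<in> insert a B" by auto
    have base: "\<phi> a d \<in> vec.span (?X \<union> ?Y)" if "d \<in> B" for d
      using that by (intro vec.span_base) auto
    consider "b = a" "c = a" | "b = a" "c \<in> B" | "b \<in> B" "c = a" | "b \<in> B" "c \<in> B"
      using v by blast
    then show "v \<in> vec.span (?X \<union> ?Y)"
    proof cases
      case 1
      then show ?thesis using v(1) insert.prems(2)[of a] vec.span_zero by simp
    next
      case 2
      then show ?thesis using v(1) base by simp
    next
      case 3
      then have "\<phi> b c = - \<phi> a b" using insert.prems(1)[of b a] by simp
      then show ?thesis using v(1) vec.span_neg[OF base[OF 3(1)]] by simp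
    next
      case 4
      then show ?thesis using v(1) by (intro vec.span_base) blast
    qed
  qed
  then have "vec.dim {\<phi> b c | b c. b \<in> insert a B \<and> c \<in> insert a B} \<le> vec.dim (?X \<union> ?Y)"
    by (rule vec.dim_mono)
  also have "\<dots> \<le> vec.dim ?X + vec.dim ?Y" by (rule dim_Un_le)
  also have "vec.dim ?X \<le> card B choose 2"
    by (rule insert.IH; intro insert.prems; simp)
  also have "vec.dim ?Y \<le> card B"
    using vec.dim_le_card[of ?Y ?Y] vec.span_superset[of ?Y] card_image_le[of B "\<phi> a"] insert.hyps(1)
    by (meson finite_imageI le_trans)
  finally show ?case
    using insert.hyps choose_two_Suc[of "card B"] by simp
qed

text \<open>Choose members of \<open>S\<close> whose values at \<open>z\<close> form a basis of Sz.
  Subtracting a combination of them turns any \<open>M\<close> into an \<open>L\<close> with Lz =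
  0.\<close>

lemma dim_ev_split:
  fixes S :: "('a::field^'n^'m) set" and Q :: "'a^'m^'k"
  assumes ms: "matrix_subspace S"
  shows "vec.dim ((*v) Q ` ev S x) \<le> vec.dim (ev S z) + vec.dim {Q *v (L *v x) | L. L \<in> S \<and> L *v z = 0}"
proof -
  let ?D = "{Q *v (L *v x) | L. L \<in> S \<and> L *v z = 0}"
  obtain B where B: "B \<subseteq> ev S z" "vec.independent B" "ev S z \<subseteq> vec.span B" "card B = vec.dim (ev S z)"
    using vec.basis_exists[of "ev S z"] by metis
  have fin: "finite B" using B(2) vec.finiteI_independent by blast
  obtain N where N: "\<And>b. b \<in> B \<Longrightarrow> N b \<in> S \<and> N b *v z = b"
  proof -
    have "\<forall>b\<in>B. \<exists>M. M \<in> S \<and> M *v z = b" using B(1) by (fastforce simp: ev_def)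
    then show thesis using that by metis
  qed
  let ?C = "(\<lambda>b. Q *v (N b *v x)) ` B"
  let ?Y = "{y. \<exists>M\<in>S. M *v z = y \<and> Q *v (M *v x) \<in> vec.span ?C}"
  have "vec.span B \<subseteq> ?Y"
  proof (rule vec.span_minimal)
    show "B \<subseteq> ?Y" using N by (auto intro: vec.span_base)
    show "vec.subspace ?Y"
    proof (rule vec.subspaceI)
      show "0 \<in> ?Y" using ms_zero[OF ms] vec.span_zero by (auto intro!: bexI[of _ 0])
    next
      fix a b assume "a \<in> ?Y" "b \<in> ?Y"
      then obtain A C where "A \<in> S" "C \<in> S" "A *v z = a" "C *v z = b"
          "Q *v (A *v x) \<in> vec.span ?C" "Q *v (C *v x) \<in> vec.span ?C" by auto
      then show "a + b \<in> ?Y"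
        using ms_add[OF ms, of A C] vec.span_add by (auto intro!: bexI[of _ "A + C"])
    next
      fix k a assume "a \<in> ?Y"
      then obtain A where "A \<in> S" "A *v z = a" "Q *v (A *v x) \<in> vec.span ?C" by auto
      then show "k *s a \<in> ?Y"
        using ms_scale[OF ms, of A k] vec.span_scale by (auto intro!: bexI[of _ "mscale k A"])
    qed
  qed
  then have sub: "ev S z \<subseteq> ?Y" using B(3) by auto
  have "(*v) Q ` ev S x \<subseteq> vec.span (?C \<union> ?D)"
  proof
    fix v assume "v \<in> (*v) Q ` ev S x"
    then obtain M where M: "M \<in> S" "v = Q *v (M *v x)" by (auto simp: ev_def)
    then have "M *v z \<in> ?Y" using sub evI by blast
    then obtain M' where M': "M' \<in> S" "M' *v z = M *v z" "Q *v (M' *v x) \<in> vec.span ?C" by auto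
    have "Q *v ((M - M') *v x) \<in> ?D"
      using ms_diff[OF ms M(1) M'(1)] M'(2) by (auto intro!: exI[of _ "M - M'"])
    then have "Q *v ((M - M') *v x) \<in> vec.span (?C \<union> ?D)" by (intro vec.span_base) blast
    moreover have "Q *v (M' *v x) \<in> vec.span (?C \<union> ?D)"
      using M'(3) vec.span_mono[of ?C "?C \<union> ?D"] by blast
    ultimately have "Q *v ((M - M') *v x) + Q *v (M' *v x) \<in> vec.span (?C \<union> ?D)"
      by (rule vec.span_add)
    then show "v \<in> vec.span (?C \<union> ?D)" using M(2) by simp
  qed
  then have "vec.dim ((*v) Q ` ev S x) \<le> vec.dim ?C + vec.dim ?D"
    using vec.dim_mono dim_Un_le le_trans by meson
  moreover have "vec.dim ?C \<le> card B"
    using vec.dim_le_card[of ?C ?C] vec.span_superset[of ?C] card_image_le[OF fin] fin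
    by (meson finite_imageI le_trans)
  ultimately show ?thesis using B(4) by linarith
qed

text \<open>The complement of the kernel of \<open>P\<close> is chosen through \<open>x\<close>, so
  that \<open>x\<close> has no kernel component in the resulting normal form.\<close>

lemma pseudo_inverse_exists:
  fixes P :: "'a::field^'n^'m"
  assumes "P *v x \<noteq> 0"
  obtains G :: "'a^'m^'n" where "\<And>v. P *v (G *v (P *v v)) = P *v v"
    "\<And>w. G *v (P *v (G *v w)) = G *v w" "G *v (P *v x) = x"
proof -
  let ?K = "{v. P *v v = 0}"
  have "?K \<inter> vec.span {x} = {0}"
  proof -
    have "v = 0" if v: "P *v v = 0" "v \<in> vec.span {x}" for v
    proof -
      obtain k where "v = k *s x" using v(2) by (rule span_singletonE)
      then show ?thesis using v(1) assms by (auto simp: vec.scale_eq_0_iff)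
    qed
    then show ?thesis using vec.span_zero by auto
  qed
  then obtain U where U: "vec.subspace U" "vec.span {x} \<subseteq> U" "?K \<inter> U = {0}"
      "\<And>v. \<exists>a\<in>?K. \<exists>u\<in>U. v = a + u"
    using complement_exists[OF subspace_ker[of P] vec.subspace_span[of "{x}"]] by metis
  have "inj_on ((*v) P) U"
    using U(3) vec.inj_on_iff_eq_0[of U P] U(1) by auto
  then obtain g where g: "g ` UNIV \<subseteq> U" "Vector_Spaces.linear (*s) (*s) g" "\<forall>v\<in>U. g (P *v v) = v"
    using vec.linear_exists_left_inverse_on[of "(*v) P" U] U(1) by auto
  have G: "matrix g *v w = g w" for w by (rule matrix_works[OF g(2)])
  show thesis
  proof (rule that[of "matrix g"])
    show "P *v (matrix g *v (P *v v)) = P *v v" for v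
    proof -
      obtain a u where "P *v a = 0" "u \<in> U" "v = a + u" using U(4)[of v] by auto
      then show ?thesis using g(3) G by simp
    qed
    show "matrix g *v (P *v (matrix g *v w)) = matrix g *v w" for w
      using g(1,3) G by auto
    show "matrix g *v (P *v x) = x"
      using g(3) G U(2) vec.span_base[of x "{x}"] by auto
  qed
qed

text \<open>A generalized inverse \<open>G\<close> of \<open>P\<close> encodes the splitting of both
  spaces, so the block form is available without a change of basis.\<close>

locale normal_form =
  fixes S :: "('a::field^'n^'m) set" and P :: "'a^'n^'m" and G :: "'a^'m^'n"
  assumes bounded: "bounded_rank S (rank P)" and PS: "P \<in> S"
    and PGP: "\<And>v. P *v (G *v (P *v v)) = P *v v"
    and GPG: "\<And>w. G *v (P *v (G *v w)) = G *v w"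
    and large: "2 \<le> rank P"
begin

abbreviation "r \<equiv> rank P"

text \<open>\<open>Q\<close> projects along the image of \<open>P\<close>, so \<open>QM\<close> is the lower left block \<open>B(M)\<close> of \<open>M\<close> when \<open>P\<close> is
  brought to the form \<open>diag (I\<^sub>r, 0)\<close>; the range \<open>U\<close> of \<open>G\<close> complements the kernel of \<open>P\<close>, and
  \<open>Mz\<close> (\<open>z\<close> in this kernel) is a column of the upper right block \<open>C(M)\<close>.\<close>

definition "Q = mat 1 - P ** G"

definition "U = range ((*v) G)"

section \<open>The block identities and their polarizations\<close>

lemma ms: "matrix_subspace S"
  using bounded by (rule bounded_rank_ms)

lemma Q_mv: "Q *v w = w - P *v (G *v w)"
  by (simp add: Q_def)

lemma Q_zero_iff: "Q *v w = 0 \<longleftrightarrow> w \<in> range ((*v) P)"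
proof
  assume "Q *v w = 0"
  then have "w = P *v (G *v w)" by (simp add: Q_mv)
  then show "w \<in> range ((*v) P)" by (metis rangeI)
next
  assume "w \<in> range ((*v) P)"
  then show "Q *v w = 0" by (auto simp: Q_mv PGP)
qed

lemma PG_range: "Q *v w = 0 \<Longrightarrow> P *v (G *v w) = w"
  by (simp add: Q_mv)

lemma subspace_U: "vec.subspace U"
  unfolding U_def by (rule subspace_image_mv[OF vec.subspace_UNIV])

lemma G_in_U [simp]: "G *v w \<in> U"
  by (simp add: U_def)

lemma GP_U: "u \<in> U \<Longrightarrow> G *v (P *v u) = u"
  by (auto simp: U_def GPG)

lemma dim_U: "vec.dim U = r"
proof -
  have U: "U = (*v) G ` range ((*v) P)"
  proof (intro equalityI subsetI)
    fix u assume "u \<in> U"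
    then have "u = G *v (P *v u)" by (simp add: GP_U)
    then show "u \<in> (*v) G ` range ((*v) P)" by (rule image_eqI) simp
  qed auto
  have "inj_on ((*v) G) (range ((*v) P))"
  proof (rule inj_onI)
    fix a b assume "a \<in> range ((*v) P)" "b \<in> range ((*v) P)" "G *v a = G *v b"
    then show "a = b" by (metis PGP imageE)
  qed
  then show ?thesis
    unfolding U rank_dim_range_field
    using vec.dim_image_eq[of "(*v) G" "range ((*v) P)"]
      vec.span_eq_iff[THEN iffD2, OF subspace_image_mv[OF vec.subspace_UNIV, of P]] by simp
qed

lemma QM_ker: "M \<in> S \<Longrightarrow> P *v z = 0 \<Longrightarrow> Q *v (M *v z) = 0"
  using maximal_rank_range[OF bounded PS] Q_zero_iff by blast

lemma QM_GP: "M \<in> S \<Longrightarrow> Q *v (M *v (G *v (P *v v))) = Q *v (M *v v)"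
  using QM_ker[of M "v - G *v (P *v v)"] by (simp add: PGP)

lemma QMGM: "M \<in> S \<Longrightarrow> P *v z = 0 \<Longrightarrow> Q *v (M *v (G *v (M *v z))) = 0"
  using maximal_rank_range2[OF bounded PS] Q_zero_iff PG_range QM_ker by blast

lemma QMGMGM: "M \<in> S \<Longrightarrow> P *v z = 0 \<Longrightarrow> Q *v (M *v (G *v (M *v (G *v (M *v z))))) = 0"
  using maximal_rank_range3[OF bounded PS] Q_zero_iff PG_range QM_ker QMGM by blast

lemma alt: 
  assumes "M \<in> S" "N \<in> S" "P *v z = 0"
  shows "Q *v (M *v (G *v (N *v z))) = - (Q *v (N *v (G *v (M *v z))))"
  using QMGM[OF ms_add[OF ms assms(1,2)] assms(3)] QMGM[OF assms(1,3)] QMGM[OF assms(2,3)]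
  by (simp add: eq_neg_iff_add_eq_0 add.commute)

text \<open>Polarization of BAC = 0. At N + sM the coefficients \<open>a\<close> of s and
  \<open>b\<close> of s^2 satisfy sa + s^2 b = 0 for every scalar s. Comparing s = 1 with a scalar
  outside {0, 1}, available as #K > r >= 2, forces a = 0.\<close>

lemma cubic:
  assumes "M \<in> S" "N \<in> S" "P *v z = 0"
  shows "Q *v (M *v (G *v (N *v (G *v (N *v z))))) + Q *v (N *v (G *v (M *v (G *v (N *v z)))))
    + Q *v (N *v (G *v (N *v (G *v (M *v z))))) = 0" 
proof -
  define a where "a = Q *v (M *v (G *v (N *v (G *v (N *v z))))) + Q *v (N *v (G *v (M *v (G *v (N *v z)))))
    + Q *v (N *v (G *v (N *v (G *v (M *v z)))))"
  have "exceeds (UNIV :: 'a set) 2"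
    using bounded large exceeds_mono by (auto simp: bounded_rank_def)
  moreover have "card {0, 1 :: 'a} \<le> 2" by simp
  ultimately obtain t :: 'a where "t \<notin> {0, 1}"
    using exceeds_obtain by (metis finite.emptyI finite.insertI)
  then have t: "t \<noteq> 0" "t \<noteq> 1" by auto
  define b where "b = Q *v (N *v (G *v (M *v (G *v (M *v z))))) + Q *v (M *v (G *v (N *v (G *v (M *v z)))))
    + Q *v (M *v (G *v (M *v (G *v (N *v z)))))"
  have eq: "s *s a + (s * s) *s b = 0" for s
  proof -
    have "Q *v ((N + mscale s M) *v (G *v ((N + mscale s M) *v (G *v ((N + mscale s M) *v z))))) = 0"
      using QMGMGM[OF ms_add[OF ms assms(2) ms_scale[OF ms assms(1)]] assms(3)] .
    then show ?thesis
      using QMGMGM[OF assms(1,3)] QMGMGM[OF assms(2,3)]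
      by (simp add: a_def b_def vector_add_ldistrib vector_smult_assoc ac_simps)
  qed
  have "a + b = 0" using eq[of 1] by simp
  then have b: "b = - a" by (simp add: eq_neg_iff_add_eq_0 add.commute)
  have "t *s a - (t * t) *s a = 0" using eq[of t] b by (simp add: vec.scale_minus_right)
  then have "(t * (1 - t)) *s a = 0"
    by (simp add: right_diff_distrib vec.scale_left_diff_distrib)
  then have "a = 0" using t by (simp add: vec.scale_eq_0_iff)
  then show ?thesis by (simp add: a_def)
qed

text \<open>The left side of \<open>cubic\<close> is quadratic in its second matrix; this is its
  polar form.\<close>

lemma trilinear:
  assumes "M \<in> S" "N \<in> S" "L \<in> S" "P *v z = 0"
  shows "Q *v (M *v (G *v (N *v (G *v (L *v z))))) + Q *v (M *v (G *v (L *v (G *v (N *v z)))))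
    + Q *v (N *v (G *v (M *v (G *v (L *v z))))) + Q *v (N *v (G *v (L *v (G *v (M *v z)))))
    + Q *v (L *v (G *v (M *v (G *v (N *v z))))) + Q *v (L *v (G *v (N *v (G *v (M *v z))))) = 0"
(is "?six = 0")
proof -
  define f where "f X = Q *v (M *v (G *v (X *v (G *v (X *v z))))) + Q *v (X *v (G *v (M *v (G *v (X *v z)))))
    + Q *v (X *v (G *v (X *v (G *v (M *v z)))))" for X
  have "?six = f (N + L) - f N - f L"
    by (simp add: f_def algebra_simps)
  also have "\<dots> = 0"
    using cubic[OF assms(1) ms_add[OF ms assms(2,3)] assms(4)] cubic[OF assms(1,2,4)] cubic[OF assms(1,3,4)]
    unfolding f_def by (simp only: diff_zero)
  finally show ?thesis .
qed

section \<open>The lower left block on the copy of Sz\<close>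

lemma dim_ev_le: "vec.dim (ev S x) \<le> r + vec.dim ((*v) Q ` ev S x)"
proof -
  have "vec.dim {y\<in>ev S x. Q *v y = 0} \<le> r"
    unfolding rank_dim_range_field using Q_zero_iff by (intro vec.dim_subset) auto
  then show ?thesis using dim_image_ker[OF subspace_ev[OF ms], of Q x] by linarith
qed

text \<open>Sz lives in the target, inside the image of \<open>P\<close> when Pz = 0. This is its
  copy in \<open>U\<close>, where matrices of \<open>S\<close> can be applied again.\<close>

definition "T z = (*v) G ` ev S z"

lemma T_I: "M \<in> S \<Longrightarrow> G *v (M *v z) \<in> T z"
  by (auto simp: T_def ev_def)

lemma T_E:
  assumes "t \<in> T z"
  obtains M where "M \<in> S" "t = G *v (M *v z)"
  using assms by (auto simp: T_def ev_def)

lemma subspace_T: "vec.subspace (T z)"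
  unfolding T_def by (rule subspace_image_mv[OF subspace_ev[OF ms]])

lemma T_sub_U: "T z \<subseteq> U"
  by (auto elim!: T_E)

lemma dim_T:
  assumes "P *v z = 0"
  shows "vec.dim (T z) = vec.dim (ev S z)"
proof -
  have "inj_on ((*v) G) (ev S z)"
  proof (rule inj_onI)
    fix a b assume "a \<in> ev S z" "b \<in> ev S z" "G *v a = G *v b"
    then show "a = b" using PG_range QM_ker assms by (auto simp: ev_def) metis
  qed
  then show ?thesis
    unfolding T_def using vec.dim_image_eq[of "(*v) G" "ev S z"]
      vec.span_eq_iff[THEN iffD2, OF subspace_ev[OF ms, of z]] by simp
qed

lemma QL_T: 
  assumes "L \<in> S" "L *v z = 0" "P *v z = 0" "t \<in> T z"
  shows "Q *v (L *v t) = 0"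
proof -
  obtain M where M: "M \<in> S" "t = G *v (M *v z)" using assms(4) by (rule T_E)
  show ?thesis using alt[OF assms(1) M(1) assms(3)] assms(2) M(2) by simp
qed

lemma dim_lower_on_T:
  assumes z: "P *v z = 0"
  shows "vec.dim (spanned (lmul Q S) (T z)) \<le> vec.dim (ev S z) choose 2"
proof -
  obtain B where B: "B \<subseteq> ev S z" "vec.independent B" "ev S z \<subseteq> vec.span B" "card B = vec.dim (ev S z)"
    using vec.basis_exists[of "ev S z"] by metis
  have fin: "finite B" using B(2) vec.finiteI_independent by blast
  obtain N where N: "\<And>b. b \<in> B \<Longrightarrow> N b \<in> S \<and> N b *v z = b"
  proof -
    have "\<forall>b\<in>B. \<exists>M. M \<in> S \<and> M *v z = b" using B(1) by (fastforce simp: ev_def)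
    then show thesis using that by metis
  qed
  define \<phi> where "\<phi> b c = Q *v (N b *v (G *v c))" for b c
  let ?X = "{\<phi> b c | b c. b \<in> B \<and> c \<in> B}"
  have "vec.dim ?X \<le> card B choose 2"
  proof (rule dim_alternating_le[OF fin])
    show "\<phi> b c = - \<phi> c b" if "b \<in> B" "c \<in> B" for b c
      using alt[of "N b" "N c" z] N that z by (simp add: \<phi>_def)
    show "\<phi> b b = 0" if "b \<in> B" for b
      using QMGM[of "N b" z] N that z by (simp add: \<phi>_def)
  qed
  moreover have "spanned (lmul Q S) (T z) \<subseteq> vec.span ?X"
    unfolding spanned_def
  proof (rule vec.span_minimal)
    show "{N *v u |N u. N \<in> lmul Q S \<and> u \<in> T z} \<subseteq> vec.span ?X"
    proof
      fix v assume "v \<in> {N *v u |N u. N \<in> lmul Q S \<and> u \<in> T z}"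
      then obtain M t where M: "M \<in> S" and t: "t \<in> T z" and v: "v = Q *v (M *v t)"
        by (auto simp: lmul_def)
      have 1: "Q *v (N b *v (G *v y)) \<in> vec.span ?X" if b: "b \<in> B" and y: "y \<in> ev S z" for b y
      proof -
        have "(*v) (Q ** N b ** G) ` vec.span B = vec.span ((*v) (Q ** N b ** G) ` B)"
          by (rule vec.span_image[symmetric])
        moreover have "(*v) (Q ** N b ** G) ` B \<subseteq> ?X" using b by (auto simp: \<phi>_def)
        ultimately have "(Q ** N b ** G) *v y \<in> vec.span ?X"
          using y B(3) vec.span_mono by blast
        then show ?thesis by simp
      qed
      \<comment> \<open>A general \<open>M\<close> is none of the \<open>N b\<close>. Alternation
        exchanges the two, and the value Mz is then covered by claim 1.\<close>
      have 2: "Q *v (M *v (G *v b)) \<in> vec.span ?X" if b: "b \<in> B" for b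
      proof -
        have "Q *v (M *v (G *v b)) = - (Q *v (N b *v (G *v (M *v z))))"
          using alt[OF M, of "N b" z] N[OF b] z by simp
        then show ?thesis using vec.span_neg[OF 1[OF b evI[OF M]]] by simp
      qed
      have "(*v) (Q ** M ** G) ` vec.span B = vec.span ((*v) (Q ** M ** G) ` B)"
        by (rule vec.span_image[symmetric])
      also have "\<dots> \<subseteq> vec.span ?X"
        using 2 by (intro vec.span_minimal) auto
      finally have 3: "(*v) (Q ** M ** G) ` vec.span B \<subseteq> vec.span ?X" .
      obtain y where "y \<in> ev S z" "t = G *v y" using t by (auto simp: T_def)
      then show "v \<in> vec.span ?X" using 3 B(3) v by auto
    qed
  qed simp
  then have "vec.dim (spanned (lmul Q S) (T z)) \<le> vec.dim ?X" by (rule vec.dim_mono)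
  ultimately show ?thesis unfolding B(4)[symmetric] by linarith
qed

text \<open>With q = dim Sz, the common kernel modulo \<open>?W\<close> contains the kernel of
  \<open>P\<close> and \<open>T z\<close>, of total dimension n - r + q. The column property makes
  each kernel strictly larger, so the rank is at most r - q - 1 and the triangular bound
  applies.\<close>

lemma dim_lower_le:
  assumes z: "P *v z = 0" and cp: "colprop S"
  shows "vec.dim (img (lmul Q S)) \<le> (vec.dim (ev S z) choose 2) + ((r - vec.dim (ev S z)) choose 2)"
proof -
  let ?q = "vec.dim (ev S z)"
  let ?W = "spanned (lmul Q S) (T z)"
  have W: "vec.subspace ?W" "?W \<subseteq> img (lmul Q S)"
    by (simp add: spanned_def, unfold spanned_def img_def, rule vec.span_mono) (auto simp: ev_def)
  obtain R :: "'a^'m^'m" where R: "\<And>y. R *v y = 0 \<longleftrightarrow> y \<in> ?W"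
    using annihilator_exists[OF W(1)] by metis
  let ?S2 = "lmul R (lmul Q S)"
  have ms2: "matrix_subspace ?S2" using ms by (intro matrix_subspace_lmul)
  have cp2: "colprop ?S2" using cp by (intro colprop_lmul)
  have eq: "vec.dim (img ?S2) + vec.dim ?W = vec.dim (img (lmul Q S))"
    unfolding img_lmul[of R] by (rule dim_ker_image[OF R subspace_img W(2)])
  have "vec.dim (img ?S2) \<le> (r - ?q) choose 2"
  proof (cases "comker ?S2 = UNIV")
    case True
    then show ?thesis using dim_img_comker[OF True] by linarith
  next
    case False
    have K: "z' \<in> comker ?S2" if "P *v z' = 0" for z'
      using QM_ker that by (auto simp: comker_def lmul_def)
    have Tc: "t \<in> comker ?S2" if t: "t \<in> T z" for t
    proof -
      have "Q *v (M *v t) \<in> ?W" if "M \<in> S" for M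
        unfolding spanned_def
        by (rule vec.span_base, rule CollectI, rule exI[of _ "Q ** M"], rule exI[of _ t])
          (simp add: t lmulI that)
      then show ?thesis using R by (auto simp: comker_def lmul_def)
    qed
    have "{x + y |x y. x \<in> {v. P *v v = 0} \<and> y \<in> T z} \<subseteq> comker ?S2"
      using K Tc vec.subspace_add[OF subspace_comker] by blast
    then have "vec.dim {x + y |x y. x \<in> {v. P *v v = 0} \<and> y \<in> T z} \<le> vec.dim (comker ?S2)"
      by (rule vec.dim_subset)
    moreover have "{v. P *v v = 0} \<inter> T z = {0}"
      using GP_U T_sub_U[of z] vec.subspace_0[OF subspace_T[of z]] by force
    ultimately have dc: "vec.dim {v. P *v v = 0} + ?q \<le> vec.dim (comker ?S2)"
      using vec.dim_sums_Int[OF subspace_ker[of P] subspace_T[of z]] dim_T[OF z] by simp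
    have rk: "rank M < r - ?q" if M: "M \<in> ?S2" for M
    proof -
      obtain x where x: "M *v x = 0" "x \<notin> comker ?S2"
        using colprop_ker[OF cp2 False M] .
      have sub: "comker ?S2 \<subseteq> {x. M *v x = 0}" using M by (auto simp: comker_def)
      have "comker ?S2 \<noteq> {x. M *v x = 0}" using x by auto
      then have "vec.dim (comker ?S2) < vec.dim {x. M *v x = 0}"
        using vec.subspace_dim_equal[OF subspace_comker subspace_ker sub] by linarith
      then show ?thesis using dc rank_ker[of M] rank_ker[of P] by linarith
    qed
    have "r - ?q - 1 \<le> r" by simp
    then have "bounded_rank ?S2 (r - ?q - 1)"
      using rk ms2 bounded exceeds_mono[of "UNIV :: 'a set" r "r - ?q - 1"] by (fastforce simp: bounded_rank_def)
    then have "vec.dim (img ?S2) \<le> Suc (r - ?q - 1) choose 2"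
      using cp2 by (rule colprop_dim_img_le)
    moreover have "0 < r - ?q" using rk[OF ms_zero[OF ms2]] by simp
    then have "Suc (r - ?q - 1) = r - ?q" by linarith
    ultimately show ?thesis by simp
  qed
  then show ?thesis using eq dim_lower_on_T[OF z] by linarith
qed

text \<open>Alternation swaps the varying matrix with the fixed \<open>N\<close>, turning an
  evaluation space into the image of a single matrix.\<close>

lemma Q_ev_T:
  assumes z: "P *v z = 0" and N: "N \<in> S"
  shows "(*v) Q ` ev S (G *v (N *v z)) = (*v) (Q ** N) ` T z"
proof (intro equalityI subsetI)
  fix v assume "v \<in> (*v) Q ` ev S (G *v (N *v z))"
  then obtain M where M: "M \<in> S" "v = Q *v (M *v (G *v (N *v z)))" by (auto simp: ev_def)
  then have "v = (Q ** N) *v (- (G *v (M *v z)))" using alt[OF M(1) N z] by simp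
  then show "v \<in> (*v) (Q ** N) ` T z"
    using vec.subspace_neg[OF subspace_T T_I[OF M(1)]] by blast
next
  fix v assume "v \<in> (*v) (Q ** N) ` T z"
  then obtain M where M: "M \<in> S" "v = Q *v (N *v (G *v (M *v z)))" by (auto elim: T_E)
  then have "v = - (Q *v (M *v (G *v (N *v z))))" using alt[OF N M(1) z] by simp
  then have "v = Q *v (mscale (-1) M *v (G *v (N *v z)))" by (simp add: vec.scale_minus_left)
  then show "v \<in> (*v) Q ` ev S (G *v (N *v z))"
    using evI[OF ms_scale[OF ms M(1)]] by blast
qed

lemma dim_QN_T:
  assumes z: "P *v z = 0" and N: "N \<in> S" "G *v (N *v z) \<noteq> 0"
  shows "vec.dim ((*v) (Q ** N) ` T z) + 1 \<le> vec.dim (T z)"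
proof -
  have "G *v (N *v z) \<in> {t\<in>T z. (Q ** N) *v t = 0}"
    using QMGM[OF N(1) z] T_I[OF N(1)] by simp
  then have "\<not> {t\<in>T z. (Q ** N) *v t = 0} \<subseteq> {0}" using N(2) by blast
  then have "vec.dim {t\<in>T z. (Q ** N) *v t = 0} \<noteq> 0" by (simp only: vec.dim_eq_0 not_False_eq_True)
  then show ?thesis using dim_image_ker[OF subspace_T, of "Q ** N" z] by linarith
qed

lemma dim_ev_le_in_T:
  assumes z: "P *v z = 0" and x: "x \<in> T z" "x \<noteq> 0"
  shows "vec.dim ((*v) Q ` ev S x) + 1 \<le> vec.dim (T z)"
proof -
  obtain N where N: "N \<in> S" "x = G *v (N *v z)" using x(1) by (rule T_E)
  show ?thesis using dim_QN_T[OF z N(1)] Q_ev_T[OF z N(1)] N(2) x(2) by simp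
qed

text \<open>Here T z = U, so x = GNz and QSx is the image of QN on \<open>U\<close>. A kernel of QN
  of dimension at least 2 leaves r - 2. Otherwise the kernel is Kx; for Lz = 0 the cubic identity
  puts GLx into it, so Lx is a multiple of Px and Sx has dimension at most r + 1.\<close>

lemma full_case:
  assumes z: "P *v z = 0" and q: "vec.dim (ev S z) = r" and x: "x \<in> U" "x \<noteq> 0"
  shows "vec.dim (ev S x) \<le> max (2 * r - 2) (r + 1)"
proof -
  have TU: "T z = U"
    using vec.subspace_dim_equal[OF subspace_T subspace_U T_sub_U, of z] dim_T[OF z] dim_U q by simp
  then obtain N where N: "N \<in> S" "x = G *v (N *v z)" using x(1) T_E by metis
  let ?Y = "{t\<in>T z. (Q ** N) *v t = 0}"
  have xY: "x \<in> ?Y" using QMGM[OF N(1) z] T_I[OF N(1)] N(2) by simp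
  have dV: "vec.dim ((*v) Q ` ev S x) + vec.dim ?Y = r"
    using dim_image_ker[OF subspace_T, of "Q ** N" z] Q_ev_T[OF z N(1)] N(2) dim_T[OF z] q by simp
  show ?thesis
  proof (cases "vec.dim ?Y \<le> 1")
    case False
    then show ?thesis using dV dim_ev_le[of x] by linarith
  next
    case True
    have "L *v x \<in> vec.span {P *v x}" if L: "L \<in> S" "L *v z = 0" for L
    proof -
      have QL: "Q *v (L *v u) = 0" if "u \<in> U" for u
        using QL_T[OF L z] that TU by simp
      have "Q *v (N *v (G *v (L *v x))) = 0"
        using cubic[OF L(1) N(1) z] L(2) N(2) QL[of "G *v (N *v (G *v (N *v z)))"] by simp
      then have "G *v (L *v x) \<in> ?Y" using TU by simp
      then obtain k where k: "G *v (L *v x) = k *s x"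
        using dim_le_1_span[OF True xY x(2)] span_singletonE by blast
      have "L *v x = P *v (G *v (L *v x))" using PG_range[OF QL[OF x(1)]] by simp
      then show ?thesis using k by (simp add: vec.span_scale vec.span_base)
    qed
    then have "{mat 1 *v (L *v x) | L. L \<in> S \<and> L *v z = 0} \<subseteq> vec.span {P *v x}" by auto
    then have "vec.dim {mat 1 *v (L *v x) | L. L \<in> S \<and> L *v z = 0} \<le> card {P *v x}"
      by (intro vec.dim_le_card) simp_all
    then have "vec.dim ((*v) (mat 1) ` ev S x) \<le> r + 1"
      using dim_ev_split[OF ms, of "mat 1" x z] q by simp
    moreover have "(*v) (mat 1) ` ev S x = ev S x" by simp
    ultimately show ?thesis by simp
  qed
qed

end

section \<open>Kernel vectors with evaluation rank \<open>r - 1\<close>\<close>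

lemma span_tripleE:
  assumes "y \<in> vec.span {a, b, c}"
  obtains k l m where "y = k *s a + l *s b + m *s c"
proof -
  obtain k where "y - k *s a \<in> vec.span {b, c}"
    using assms vec.span_breakdown_eq by blast
  then obtain l m where "y - k *s a = l *s b + m *s c" by (rule span_pairE)
  then have "y = k *s a + l *s b + m *s c" by (simp add: diff_eq_eq add_ac)
  then show thesis by (rule that)
qed

text \<open>If \<open>g A\<close> and \<open>g B\<close> are independent, comparing coefficients at
  A + B identifies their factors. An \<open>A\<close> with \<open>g A\<close> on the line of
  \<open>g A1\<close> is compared with \<open>A2\<close> instead.\<close>

lemma common_factor:
  fixes f g :: "'b::plus \<Rightarrow> 'a::field^'n"
  assumes add: "\<And>A B. f (A + B) = f A + f B" "\<And>A B. g (A + B) = g A + g B"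
    and closed: "\<And>A B. A \<in> S \<Longrightarrow> B \<in> S \<Longrightarrow> A + B \<in> S"
    and factor: "\<And>A. A \<in> S \<Longrightarrow> \<exists>k. f A = k *s g A"
    and ind: "A1 \<in> S" "A2 \<in> S" "g A1 \<noteq> 0" "g A2 \<notin> vec.span {g A1}"
  shows "\<exists>k. \<forall>A\<in>S. f A = k *s g A"
proof -
  have key: "f B = a *s g B"
    if A: "A \<in> S" "f A = a *s g A" "g A \<noteq> 0" and B: "B \<in> S" "g B \<notin> vec.span {g A}" for A B a
  proof -
    obtain b where b: "f B = b *s g B" using factor[OF B(1)] by blast
    obtain k where "f (A + B) = k *s g (A + B)" using factor[OF closed[OF A(1) B(1)]] by blast
    then have eq: "(k - b) *s g B = (a - k) *s g A"
      by (simp add: add A(2) b vec.scale_left_diff_distrib vec.scale_right_distrib algebra_simps)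
    have "k = b"
    proof (rule ccontr)
      assume "k \<noteq> b"
      then have "g B = inverse (k - b) *s ((k - b) *s g B)"
        by (metis left_inverse right_minus_eq vector_smult_assoc vector_smult_lid)
      then have "g B = inverse (k - b) *s ((a - k) *s g A)" unfolding eq .
      moreover have "inverse (k - b) *s ((a - k) *s g A) \<in> vec.span {g A}"
        by (intro vec.span_scale vec.span_base) simp
      ultimately show False using B(2) by simp
    qed
    then have "(a - k) *s g A = 0" using eq by simp
    then show ?thesis using \<open>k = b\<close> b A(3) by (simp add: vec.scale_eq_0_iff)
  qed
  obtain k where k: "f A1 = k *s g A1" using factor[OF ind(1)] by blast
  have k2: "f A2 = k *s g A2" using key[OF ind(1) k ind(3) ind(2,4)] .
  have g2: "g A2 \<noteq> 0" using ind(4) vec.span_zero by metis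
  show ?thesis
  proof (intro exI ballI)
    fix A assume A: "A \<in> S"
    show "f A = k *s g A"
    proof (cases "g A \<in> vec.span {g A1}")
      case False
      then show ?thesis using key[OF ind(1) k ind(3) A] by simp
    next
      case True
      then obtain c where c: "g A = c *s g A1" by (rule span_singletonE)
      show ?thesis
      proof (cases "c = 0")
        case True
        then show ?thesis using c factor[OF A] by auto
      next
        case False
        have "g A \<notin> vec.span {g A2}"
        proof
          assume "g A \<in> vec.span {g A2}"
          then obtain d where d: "c *s g A1 = d *s g A2" unfolding c by (rule span_singletonE)
          have "d \<noteq> 0" using d False ind(3) by (auto simp: vec.scale_eq_0_iff)
          then have "g A2 = inverse d *s (d *s g A2)" by (simp add: vector_smult_assoc)
          then have "g A2 \<in> vec.span {g A1}"
            unfolding d[symmetric] by (simp add: vec.span_scale vec.span_base)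
          then show False using ind(4) by simp
        qed
        then show ?thesis using key[OF ind(2) k2 g2 A] by simp
      qed
    qed
  qed
qed

text \<open>Here \<open>T\<close> is a hyperplane of \<open>U\<close>. Semi-primitivity provides a matrix \<open>N\<close> of maximal rank and
  \<open>x0\<close> in its kernel whose \<open>U\<close>-component \<open>e\<close> is not in \<open>T\<close>; maximality of the rank of \<open>N\<close> then
  confines \<open>QMe\<close> to the image \<open>R\<close> of \<open>QN\<close> for every \<open>M\<close>.\<close>

locale corank_one = normal_form S P G
  for S :: "('a::field^'n^'m) set" and P :: "'a^'n^'m" and G :: "'a^'m^'n" +
  fixes z x x0 :: "'a^'n" and N :: "'a^'n^'m"
  assumes z: "P *v z = 0" and q: "vec.dim (ev S z) + 1 = rank P" and r3: "3 \<le> rank P"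
    and x: "x \<in> U" "x \<notin> T z"
    and N: "N \<in> S" "rank N = rank P" "N *v x0 = 0" and x0: "G *v (P *v x0) \<notin> T z"
begin

definition "e = G *v (P *v x0)"

text \<open>The copy of Nz in \<open>U\<close>. BC = 0 puts it into the kernel of QN.\<close>

definition "c = G *v (N *v z)"

definition "V = (*v) Q ` ev S x"

definition "R = (*v) (Q ** N) ` T z"

section \<open>Estimating dim V modulo R\<close>

lemma dimT: "vec.dim (T z) + 1 = r"
  using dim_T[OF z] q by simp

lemma decompose:
  assumes "e' \<in> U" "e' \<notin> T z" "u \<in> U"
  obtains k t where "t \<in> T z" "u = t + k *s e'"
proof -
  have sp: "vec.span (T z) = T z" using subspace_T by (simp only: vec.span_eq_iff)
  have "vec.dim (insert e' (T z)) = vec.dim (T z) + 1"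
    using assms(2) by (simp add: vec.dim_insert sp)
  then have "vec.dim (vec.span (insert e' (T z))) = r" using dimT by simp
  moreover have sub: "vec.span (insert e' (T z)) \<subseteq> U"
    using assms(1) T_sub_U subspace_U by (intro vec.span_minimal) auto
  ultimately have "vec.span (insert e' (T z)) = U"
    using vec.subspace_dim_equal[OF vec.subspace_span subspace_U sub] dim_U by simp
  then obtain k where "u - k *s e' \<in> T z"
    using assms(3) vec.span_breakdown_eq[of u e' "T z"] sp by blast
  then show thesis using that[of "u - k *s e'" k] by simp
qed

lemma e_U: "e \<in> U" and e_T: "e \<notin> T z"
  using x0 by (simp_all add: e_def)

lemma QNe: "Q *v (N *v e) = 0"
  unfolding e_def using QM_GP[OF N(1), of x0] N(3) by simp

lemma subspace_R: "vec.subspace R"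
  unfolding R_def by (rule subspace_image_mv[OF subspace_T])

lemma R_I: "t \<in> T z \<Longrightarrow> Q *v (N *v t) \<in> R"
  unfolding R_def by (rule image_eqI[of _ _ t]) simp_all

lemma QN_R: "Q *v (N *v v) \<in> R"
proof -
  obtain k t where t: "t \<in> T z" "G *v (P *v v) = t + k *s e"
    using decompose[OF e_U e_T G_in_U] .
  have "Q *v (N *v v) = Q *v (N *v (G *v (P *v v)))" using QM_GP[OF N(1)] by simp
  also have "\<dots> = Q *v (N *v t)" unfolding t(2) using QNe by simp
  finally show ?thesis using R_I[OF t(1)] by simp
qed

lemma Qe_R:
  assumes "M \<in> S"
  shows "Q *v (M *v e) \<in> R"
proof -
  \<comment> \<open>Maximality of rank is applied to \<open>N\<close> in place of
    \<open>P\<close>.\<close>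
  have "M *v x0 \<in> range ((*v) N)"
    using maximal_rank_range[of S N M x0] bounded N assms by simp
  then obtain v where "M *v x0 = N *v v" by auto
  then have "Q *v (M *v e) = Q *v (N *v v)"
    unfolding e_def using QM_GP[OF assms, of x0] by simp
  then show ?thesis using QN_R by simp
qed

text \<open>The coordinate of \<open>x\<close> along \<open>e\<close> modulo the hyperplane
  \<open>T z\<close>, unique because \<open>e\<close> is outside \<open>T z\<close>.\<close>

definition "\<kappa> = (SOME k. x - k *s e \<in> T z)"

definition "y = x - \<kappa> *s e"

lemma y_T: "y \<in> T z"
proof -
  obtain k t where "t \<in> T z" "x = t + k *s e" using decompose[OF e_U e_T x(1)] .
  then have "\<exists>k. x - k *s e \<in> T z" by (auto intro!: exI[of _ k])
  then show ?thesis unfolding y_def \<kappa>_def by (rule someI_ex)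
qed

lemma x_eq: "x = y + \<kappa> *s e"
  by (simp add: y_def)

lemma QM_x: "Q *v (M *v x) = \<kappa> *s (Q *v (M *v e)) + Q *v (M *v y)"
  using arg_cong[OF x_eq, of "\<lambda>u. Q *v (M *v u)"] by (simp add: add.commute)

text \<open>By \<open>Qe_R\<close> the \<open>e\<close>-part of \<open>x\<close> contributes only to
  \<open>R\<close>, so \<open>V\<close> lies in the sum of \<open>R\<close> and QN'(T z). What the
  second summand adds is the rank of QN' modulo \<open>R\<close> on \<open>T z\<close>; the set on
  the left is the kernel of that map.\<close>

lemma V_bound:
  assumes N': "N' \<in> S" "y = G *v (N' *v z)"
  shows "vec.dim V + vec.dim {t\<in>T z. Q *v (N' *v t) \<in> R} \<le> vec.dim R + vec.dim (T z)"
proof -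
  obtain F :: "'a^'m^'m" where F: "\<And>w. F *v w = 0 \<longleftrightarrow> w \<in> R"
    using annihilator_exists[OF subspace_R] by metis
  let ?B = "(*v) (Q ** N') ` T z"
  have subB: "vec.subspace ?B" by (rule subspace_image_mv[OF subspace_T])
  have "V \<subseteq> {a + b | a b. a \<in> R \<and> b \<in> ?B}"
  proof
    fix v assume "v \<in> V"
    then obtain M where M: "M \<in> S" "v = Q *v (M *v x)" by (auto simp: V_def ev_def)
    have "v = \<kappa> *s (Q *v (M *v e)) + Q *v (M *v y)"
      unfolding M(2) by (rule QM_x)
    moreover have "Q *v (M *v y) \<in> ?B"
      using imageI[OF evI[OF M(1)], of "(*v) Q" y] Q_ev_T[OF z N'(1)] unfolding N'(2)[symmetric] by metis
    moreover have "\<kappa> *s (Q *v (M *v e)) \<in> R"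
      by (rule vec.subspace_scale[OF subspace_R Qe_R[OF M(1)]])
    ultimately show "v \<in> {a + b | a b. a \<in> R \<and> b \<in> ?B}"
      by (intro CollectI exI conjI)
  qed
  then have "vec.dim V \<le> vec.dim {a + b | a b. a \<in> R \<and> b \<in> ?B}" by (rule vec.dim_subset)
  moreover have "vec.dim {a + b | a b. a \<in> R \<and> b \<in> ?B} + vec.dim (R \<inter> ?B) = vec.dim R + vec.dim ?B"
    by (rule vec.dim_sums_Int[OF subspace_R subB])
  moreover have "vec.dim ((*v) F ` ?B) + vec.dim (R \<inter> ?B) = vec.dim ?B"
  proof -
    have "{b\<in>?B. F *v b = 0} = R \<inter> ?B" using F by auto
    then show ?thesis using dim_image_ker[OF subB, of F] by simp
  qed
  moreover have "vec.dim ((*v) F ` ?B) + vec.dim {t\<in>T z. Q *v (N' *v t) \<in> R} = vec.dim (T z)"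
  proof -
    have "(*v) F ` ?B = (*v) (F ** Q ** N') ` T z" by (simp add: image_image)
    moreover have "{t\<in>T z. (F ** Q ** N') *v t = 0} = {t\<in>T z. Q *v (N' *v t) \<in> R}" using F by simp
    ultimately show ?thesis using dim_image_ker[OF subspace_T, of "F ** Q ** N'" z] by simp
  qed
  ultimately show ?thesis by linarith
qed

text \<open>Sending (GMz, GM'z) to QMGM'z modulo \<open>R\<close> is an alternating pairing on
  \<open>T z\<close>; this is its radical.\<close>

definition "nice = {d\<in>T z. \<forall>M\<in>S. Q *v (M *v d) \<in> R}"

lemma subspace_nice: "vec.subspace nice"
  unfolding nice_def
  using vec.subspace_0[OF subspace_R] vec.subspace_0[OF subspace_T, of z]
    vec.subspace_add[OF subspace_R] vec.subspace_add[OF subspace_T, of _ z]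
    vec.subspace_scale[OF subspace_R] vec.subspace_scale[OF subspace_T, of _ z]
  by (simp add: vec.subspace_def)

lemma c_T: "c \<in> T z"
  unfolding c_def by (rule T_I[OF N(1)])

lemma c_U: "c \<in> U"
  by (simp add: c_def)

lemma QNc: "Q *v (N *v c) = 0"
  unfolding c_def by (rule QMGM[OF N(1) z])

lemma c_nice: "c \<in> nice"
proof -
  have "Q *v (M *v c) \<in> R" if "M \<in> S" for M
    unfolding c_def alt[OF that N(1) z]
    by (rule vec.subspace_neg[OF subspace_R QN_R])
  then show ?thesis using c_T by (simp add: nice_def)
qed

lemma dim_R:
  assumes "c \<noteq> 0"
  shows "vec.dim R + 2 \<le> r"
  using dim_QN_T[OF z N(1)] assms dimT unfolding R_def c_def by linarith

lemma R_zero: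
  assumes "c = 0"
  shows "vec.dim R = 0"
proof -
  have "Q *v (N *v t) = 0" if t: "t \<in> T z" for t
  proof -
    obtain M where M: "M \<in> S" "t = G *v (M *v z)" using t by (rule T_E)
    show ?thesis unfolding M(2) alt[OF N(1) M(1) z] using assms by (simp add: c_def)
  qed
  then have "R \<subseteq> {0}" unfolding R_def by auto
  then show ?thesis by (simp only: vec.dim_eq_0)
qed

text \<open>The kernel in \<open>V_bound\<close> is the orthogonal of \<open>y\<close> for this
  pairing. It contains \<open>y\<close>, by alternation, and the radical.\<close>

lemma dim_V_nice:
  assumes "Y \<subseteq> {y} \<union> nice"
  shows "vec.dim V + vec.dim Y \<le> vec.dim R + vec.dim (T z)"
proof -
  obtain N' where N': "N' \<in> S" "y = G *v (N' *v z)" using y_T by (rule T_E)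
  have "Q *v (N' *v y) = 0" unfolding N'(2) by (rule QMGM[OF N'(1) z])
  then have "Y \<subseteq> {t\<in>T z. Q *v (N' *v t) \<in> R}"
    using assms N'(1) y_T vec.subspace_0[OF subspace_R] by (auto simp: nice_def)
  then have "vec.dim Y \<le> vec.dim {t\<in>T z. Q *v (N' *v t) \<in> R}" by (rule vec.dim_subset)
  then show ?thesis using V_bound[OF N'] by linarith
qed

lemma y_nice:
  assumes "y \<in> nice"
  shows "vec.dim V \<le> vec.dim R"
proof -
  obtain N' where N': "N' \<in> S" "y = G *v (N' *v z)" using y_T by (rule T_E)
  have "Q *v (N' *v t) \<in> R" if t: "t \<in> T z" for t
  proof -
    obtain M where M: "M \<in> S" "t = G *v (M *v z)" using t by (rule T_E)
    have "Q *v (M *v y) \<in> R" using assms M(1) by (simp add: nice_def)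
    then show ?thesis
      unfolding M(2) alt[OF N'(1) M(1) z] N'(2) by (rule vec.subspace_neg[OF subspace_R])
  qed
  then have "{t\<in>T z. Q *v (N' *v t) \<in> R} = T z" by auto
  then show ?thesis using V_bound[OF N'] by simp
qed

text \<open>If c = 0 or \<open>y\<close> is in the radical, \<open>V\<close> is too small. Otherwise
  \<open>c\<close>, being in the radical, is independent of \<open>y\<close>, and both are
  orthogonal to \<open>y\<close>.\<close>

lemma dim_V_generic:
  assumes "r \<le> vec.dim V + 1"
  shows "c \<noteq> 0" "y \<notin> nice" "vec.dim V + 3 \<le> vec.dim R + r"
proof -
  show c: "c \<noteq> 0"
  proof
    assume "c = 0"
    then have R: "vec.dim R = 0" by (rule R_zero)
    show False
    proof (cases "y = 0")
      case True
      then have "y \<in> nice" using vec.subspace_0[OF subspace_nice] by simp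
      then show False using y_nice R assms r3 by linarith
    next
      case False
      then have "vec.dim {y} = 1" by simp
      then show False using dim_V_nice[of "{y}"] R dimT assms by simp
    qed
  qed
  show y: "y \<notin> nice"
    using y_nice dim_R[OF c] assms by linarith
  have "y \<notin> vec.span {c}"
  proof
    assume "y \<in> vec.span {c}"
    moreover have "vec.span {c} \<subseteq> nice" using c_nice subspace_nice by (intro vec.span_minimal) simp_all
    ultimately show False using y by blast
  qed
  then have "2 \<le> vec.dim {c, y}" using c by (intro dim_ge_2[of c y]) simp_all
  then show "vec.dim V + 3 \<le> vec.dim R + r"
    using dim_V_nice[of "{c, y}"] c_nice dimT by simp
qed

lemma dim_V_le: "vec.dim V + 5 \<le> 2 * r"
proof (cases "r \<le> vec.dim V + 1")
  case True
  then show ?thesis using dim_V_generic[OF True] dim_R by linarith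
next
  case False
  then show ?thesis using r3 by linarith
qed

end

text \<open>Equality in \<open>dim_V_le\<close>, to be refuted. It forces equality in the estimates
  behind it, among them that of dim R.\<close>

locale extremal = corank_one +
  assumes r4: "4 \<le> rank P" and big: "2 * rank P \<le> vec.dim V + 5"
begin

lemma generic: "r \<le> vec.dim V + 1"
  using r4 big by linarith

lemmas c_nz = dim_V_generic(1)[OF generic] and y_bad = dim_V_generic(2)[OF generic]

lemma dim_R_eq: "vec.dim R + 2 = r"
  using dim_V_generic(3)[OF generic] dim_R[OF c_nz] big by linarith

lemma ker_QN_T:
  assumes "t \<in> T z" "Q *v (N *v t) = 0"
  shows "t \<in> vec.span {c}"
proof (rule dim_le_1_span[of "{t\<in>T z. (Q ** N) *v t = 0}"])
  show "vec.dim {t\<in>T z. (Q ** N) *v t = 0} \<le> 1"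
    using dim_image_ker[OF subspace_T, of "Q ** N" z] dim_R_eq dimT unfolding R_def by linarith
qed (use assms c_nz c_T QNc in simp_all)

text \<open>Otherwise \<open>N\<close> maps the kernel of \<open>P\<close> together with
  \<open>c\<close> into the line of Pc. By dimension count the kernel of \<open>N\<close> lies in
  their span, so \<open>e\<close> is a multiple of \<open>c\<close> and falls into
  \<open>T z\<close>.\<close>

lemma leaves_T: "(\<exists>z'. P *v z' = 0 \<and> G *v (N *v z') \<notin> T z) \<or> G *v (N *v c) \<notin> T z"
proof (rule ccontr)
  assume "\<not> ?thesis"
  then have K: "\<And>z'. P *v z' = 0 \<Longrightarrow> G *v (N *v z') \<in> T z" and C: "G *v (N *v c) \<in> T z" by auto
  have in_c: "w \<in> vec.span {P *v c}"
    if w: "Q *v w = 0" "G *v w \<in> T z" "Q *v (N *v (G *v w)) = 0" for w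
  proof -
    obtain k where "G *v w = k *s c" using ker_QN_T[OF w(2,3)] by (rule span_singletonE)
    then have "w = k *s (P *v c)" using PG_range[OF w(1)] by simp
    then show ?thesis by (simp add: vec.span_scale vec.span_base)
  qed
  have Nz: "N *v z' \<in> vec.span {P *v c}" if "P *v z' = 0" for z'
    using in_c[OF QM_ker[OF N(1) that] K[OF that] QMGM[OF N(1) that]] .
  have Nc: "N *v c \<in> vec.span {P *v c}"
    using in_c[OF QNc C] QMGMGM[OF N(1) z] by (simp add: c_def)
  let ?X = "vec.span (insert c {v. P *v v = 0})"
  have "P *v c \<noteq> 0"
    using GP_U[OF c_U] c_nz by auto
  moreover have spK: "vec.span {v. P *v v = 0} = {v. P *v v = 0}"
    by (simp only: vec.span_eq_iff subspace_ker)
  ultimately have "c \<notin> vec.span {v. P *v v = 0}" unfolding spK by simp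
  then have dX: "vec.dim ?X = vec.dim {v. P *v v = 0} + 1"
    by (simp add: vec.dim_insert)
  have "(*v) N ` ?X \<subseteq> vec.span {P *v c}"
  proof -
    have "(*v) N ` ?X = vec.span ((*v) N ` insert c {v. P *v v = 0})"
      by (rule vec.span_image[symmetric])
    also have "\<dots> \<subseteq> vec.span {P *v c}" using Nz Nc by (intro vec.span_minimal) auto
    finally show ?thesis .
  qed
  then have "vec.dim ((*v) N ` ?X) \<le> card {P *v c}" by (intro vec.dim_le_card) simp_all
  then have "vec.dim {v. N *v v = 0} \<le> vec.dim {v\<in>?X. N *v v = 0}"
    using dim_image_ker[OF vec.subspace_span, of N "insert c {v. P *v v = 0}"] dX
      rank_ker[of P] rank_ker[of N] N(2) by simp
  moreover have "vec.subspace {v\<in>?X. N *v v = 0}"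
    using vec.subspace_inter[OF vec.subspace_span subspace_ker[of N]] by (simp add: Int_def)
  ultimately have "{v\<in>?X. N *v v = 0} = {v. N *v v = 0}"
    using subspace_ker[of N] by (intro vec.subspace_dim_equal) auto
  then have "x0 \<in> ?X" using N(3) by auto
  then obtain k where k: "x0 - k *s c \<in> vec.span {v. P *v v = 0}"
    using vec.span_breakdown_eq by blast
  then have "P *v (x0 - k *s c) = 0" unfolding spK by (rule CollectD)
  then have "P *v x0 = P *v (k *s c)" by simp
  then have "e = k *s c"
    unfolding e_def using GP_U[OF c_U] by simp
  then show False using e_T vec.subspace_scale[OF subspace_T c_T] by simp
qed

text \<open>QL vanishes on \<open>T z\<close>. If QLx is nonzero, QL has rank one and kernel
  \<open>T z\<close> on \<open>U\<close>. Then GL, applied to z' or \<open>c\<close> from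
  \<open>leaves_T\<close>, gives a \<open>d\<close> in the radical with QNd nonzero, hence not in
  Kc. Now \<open>c\<close>, \<open>d\<close>, \<open>y\<close> are independent and orthogonal to
  \<open>y\<close>, one vector too many for dim V = 2r - 5.\<close>

lemma QL_x:
  assumes L: "L \<in> S" "L *v z = 0"
  shows "Q *v (L *v x) = 0"
proof (rule ccontr)
  assume nz: "Q *v (L *v x) \<noteq> 0"
  define w where "w = Q *v (L *v e)"
  note QLT = QL_T[OF L z]
  have "Q *v (L *v x) = \<kappa> *s w"
    unfolding QM_x by (simp add: w_def QLT[OF y_T])
  then have w: "w \<noteq> 0" using nz by auto
  have QLw: "\<exists>k. Q *v (L *v v) = k *s w" for v
  proof -
    obtain k t where t: "t \<in> T z" "G *v (P *v v) = t + k *s e"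
      using decompose[OF e_U e_T G_in_U] .
    have "Q *v (L *v v) = Q *v (L *v (G *v (P *v v)))" using QM_GP[OF L(1)] by simp
    also have "\<dots> = k *s w" unfolding t(2) by (simp add: w_def QLT[OF t(1)])
    finally show ?thesis by blast
  qed
  have QL0: "u \<in> T z" if u: "u \<in> U" "Q *v (L *v u) = 0" for u
  proof -
    obtain k t where t: "t \<in> T z" "u = t + k *s e" using decompose[OF e_U e_T u(1)] .
    then have "k *s w = 0" using u(2) QLT[OF t(1)] by (simp add: w_def)
    then show ?thesis using w t by (simp add: vec.scale_eq_0_iff)
  qed
  have w_R: "w \<in> R" if d: "Q *v (N *v d) = - (Q *v (L *v v))" "Q *v (L *v v) \<noteq> 0" for d v
  proof -
    obtain k where k: "Q *v (L *v v) = k *s w" using QLw by blast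
    then have k0: "k \<noteq> 0" using d(2) by auto
    have "- (Q *v (N *v d)) \<in> R" using vec.subspace_neg[OF subspace_R QN_R] .
    then have "k *s w \<in> R" using d(1) k by simp
    then have "inverse k *s (k *s w) \<in> R" by (rule vec.subspace_scale[OF subspace_R])
    then show ?thesis using k0 by simp
  qed
  have QL_R: "Q *v (L *v v) \<in> R" if "w \<in> R" for v
    using QLw[of v] vec.subspace_scale[OF subspace_R that] by auto
  obtain d where d: "d \<in> nice" "Q *v (N *v d) \<noteq> 0"
    using leaves_T
  proof
    assume "\<exists>z'. P *v z' = 0 \<and> G *v (N *v z') \<notin> T z"
    then obtain z' where z': "P *v z' = 0" "G *v (N *v z') \<notin> T z" by blast
    let ?d = "G *v (L *v z')"
    have dT: "?d \<in> T z" using QL0[OF G_in_U QMGM[OF L(1) z'(1)]] .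
    have QNd: "Q *v (N *v ?d) = - (Q *v (L *v (G *v (N *v z'))))"
      using alt[OF N(1) L(1) z'(1)] .
    have nz: "Q *v (L *v (G *v (N *v z'))) \<noteq> 0" using QL0[OF G_in_U] z'(2) by blast
    have wR: "w \<in> R" using w_R[OF QNd nz] .
    have "Q *v (M *v ?d) \<in> R" if "M \<in> S" for M
      unfolding alt[OF that L(1) z'(1)] by (rule vec.subspace_neg[OF subspace_R QL_R[OF wR]])
    then have "?d \<in> nice" using dT by (simp add: nice_def)
    then show thesis using that[of ?d] QNd nz by simp
  next
    assume c': "G *v (N *v c) \<notin> T z"
    let ?d = "G *v (L *v c)"
    have "Q *v (L *v ?d) = 0"
      using cubic[OF N(1) L(1) z] L(2) by (simp add: c_def)
    then have dT: "?d \<in> T z" using QL0[OF G_in_U] by blast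
    have QNd: "Q *v (N *v ?d) = - (Q *v (L *v (G *v (N *v c))))"
      using cubic[OF L(1) N(1) z] L(2) by (simp add: c_def eq_neg_iff_add_eq_0 add.commute)
    have nz: "Q *v (L *v (G *v (N *v c))) \<noteq> 0" using QL0[OF G_in_U] c' by blast
    have wR: "w \<in> R" using w_R[OF QNd nz] .
    have "Q *v (M *v ?d) \<in> R" if M: "M \<in> S" for M
    proof -
      have "Q *v (M *v ?d) = - (Q *v (N *v (G *v (L *v (G *v (M *v z))))) 
          + Q *v (L *v (G *v (M *v c))) + Q *v (L *v (G *v (N *v (G *v (M *v z))))))"
        using trilinear[OF M N(1) L(1) z] L(2) unfolding eq_neg_iff_add_eq_0
        by (simp add: c_def add.assoc)
      then show ?thesis
        using vec.subspace_neg[OF subspace_R] vec.subspace_diff[OF subspace_R] QN_R QL_R[OF wR] by simp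
    qed
    then have "?d \<in> nice" using dT by (simp add: nice_def)
    then show thesis using that[of ?d] QNd nz by simp
  qed
  have dc: "d \<notin> vec.span {c}"
  proof
    assume "d \<in> vec.span {c}"
    then obtain k where "d = k *s c" by (rule span_singletonE)
    then show False using d(2) QNc by simp
  qed
  have "vec.span {d, c} \<subseteq> nice" using d(1) c_nice subspace_nice by (intro vec.span_minimal) simp_all
  then have "y \<notin> vec.span {d, c}" using y_bad by blast
  then have "3 \<le> vec.dim {c, d, y}" using c_nz dc by (intro dim_ge_3[of c d y]) simp_all
  then show False
    using dim_V_nice[of "{c, d, y}"] c_nice d(1) dimT dim_R_eq big r4 by simp
qed

text \<open>By \<open>QL_x\<close>, QMx depends only on Mz, so dim V <= r - 1, while dim V = 2r -
  5.\<close>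

lemma r_eq_4: "r = 4"
proof -
  have "{Q *v (L *v x) | L. L \<in> S \<and> L *v z = 0} \<subseteq> {0}" using QL_x by auto
  then have "vec.dim {Q *v (L *v x) | L. L \<in> S \<and> L *v z = 0} = 0" by (simp only: vec.dim_eq_0)
  then have "vec.dim V \<le> vec.dim (ev S z)"
    using dim_ev_split[OF ms, of Q x z] unfolding V_def by linarith
  then show ?thesis using q big r4 by linarith
qed

lemma QL_U:
  assumes L: "L \<in> S" "L *v z = 0" and u: "u \<in> U"
  shows "Q *v (L *v u) = 0"
proof -
  obtain k t where t: "t \<in> T z" "u = t + k *s x" using decompose[OF x u] .
  then show ?thesis using QL_T[OF L z t(1)] QL_x[OF L] by simp
qed

text \<open>\<open>T z\<close> has dimension 3 and \<open>c\<close> is in the radical, so the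
  pairing comes from a plane, where it is nonzero by \<open>y_bad\<close>. An alternating pairing of
  this kind makes the orthogonal of a nonzero vector its own line.\<close>

lemma pairing_regular:
  assumes M: "M \<in> S" "G *v (M *v z) \<notin> vec.span {c}" and t: "t \<in> T z" "Q *v (M *v t) \<in> R"
  shows "t \<in> vec.span {G *v (M *v z), c}"
proof (rule ccontr)
  let ?b = "G *v (M *v z)"
  assume nt: "t \<notin> vec.span {?b, c}"
  have ind: "vec.independent {t, ?b, c}"
    using nt M(2) c_nz by (intro vec.independent_insertI vec.independent_empty) simp_all
  have ne: "?b \<noteq> c" "t \<noteq> ?b" "t \<noteq> c"
    using M(2) nt vec.span_base[of c "{c}"] vec.span_base[of ?b "{?b, c}"] vec.span_base[of c "{?b, c}"] by auto
  have "T z \<subseteq> vec.span {t, ?b, c}"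
    using ind ne t(1) c_T T_I[OF M(1), of z] dimT r_eq_4
    by (intro vec.card_ge_dim_independent) simp_all
  then have basis: "\<exists>k l m. s = k *s t + l *s ?b + m *s c" if "s \<in> T z" for s
    using that span_tripleE by blast
  note R_add = vec.subspace_add[OF subspace_R] and R_scale = vec.subspace_scale[OF subspace_R]
    and R_neg = vec.subspace_neg[OF subspace_R] and R_diff = vec.subspace_diff[OF subspace_R]
  have Rc: "Q *v (M' *v c) \<in> R" if "M' \<in> S" for M'
    using c_nice that by (simp add: nice_def)
  have Rb: "Q *v (M' *v ?b) \<in> R" if M': "M' \<in> S" for M'
  proof -
    obtain k l m where "G *v (M' *v z) = k *s t + l *s ?b + m *s c" using basis[OF T_I[OF M']] by blast
    then have "Q *v (M' *v ?b) = - (k *s (Q *v (M *v t)) + m *s (Q *v (M *v c)))"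
      using alt[OF M' M(1) z] QMGM[OF M(1) z] by simp
    then show ?thesis using R_neg R_diff R_scale t(2) Rc[OF M(1)] by simp
  qed
  have Rt: "Q *v (M' *v t) \<in> R" if M': "M' \<in> S" for M'
  proof -
    obtain N3 where N3: "N3 \<in> S" "t = G *v (N3 *v z)" using t(1) by (rule T_E)
    obtain k l m where "G *v (M' *v z) = k *s t + l *s ?b + m *s c" using basis[OF T_I[OF M']] by blast
    then have "Q *v (M' *v t) = - (l *s (Q *v (N3 *v ?b)) + m *s (Q *v (N3 *v c)))"
      using alt[OF M' N3(1) z] QMGM[OF N3(1) z] N3(2) by simp
    then show ?thesis using R_neg R_diff R_scale Rb[OF N3(1)] Rc[OF N3(1)] by simp
  qed
  obtain k l m where "y = k *s t + l *s ?b + m *s c" using basis[OF y_T] by blast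
  then have "Q *v (M' *v y) \<in> R" if "M' \<in> S" for M'
    using R_add R_scale Rt[OF that] Rb[OF that] Rc[OF that] by simp
  then show False using y_bad y_T by (simp add: nice_def)
qed

text \<open>The vectors \<open>v1\<close>, \<open>v2\<close> are the coefficients of \<open>s\<close> and \<open>s\<^sup>2\<close> when a polynomial vector \<open>v(M)\<close>
  annihilated by \<open>QM\<close> and with \<open>v(N) = e'\<close> is expanded at \<open>N + sM\<close>.\<close>

lemma expansion:
  obtains e' where "e' \<in> U" "e' \<notin> T z" "Q *v (N *v e') = 0"
    "\<And>M. M \<in> S \<Longrightarrow> \<exists>v1\<in>U. \<exists>v2\<in>U. Q *v (M *v e') + Q *v (N *v v1) = 0 \<and> Q *v (M *v v1) + Q *v (N *v v2) = 0"
  using leaves_T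
proof
  assume "\<exists>z'. P *v z' = 0 \<and> G *v (N *v z') \<notin> T z"
  then obtain z' where z': "P *v z' = 0" "G *v (N *v z') \<notin> T z" by blast
  show thesis
  proof (rule that[of "G *v (N *v z')"])
    \<comment> \<open>Here v(M) = GMz' is linear in \<open>M\<close>, so the second coefficient is
      0.\<close>
    show "\<exists>v1\<in>U. \<exists>v2\<in>U. Q *v (M *v (G *v (N *v z'))) + Q *v (N *v v1) = 0 \<and> Q *v (M *v v1) + Q *v (N *v v2) = 0"
      if M: "M \<in> S" for M
      using alt[OF M N(1) z'(1)] QMGM[OF M z'(1)] vec.subspace_0[OF subspace_U]
      by (intro bexI[of _ "G *v (M *v z')"] bexI[of _ 0]) simp_all
  qed (use z' QMGM[OF N(1) z'(1)] in simp_all)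
next
  assume c': "G *v (N *v c) \<notin> T z"
  show thesis
  proof (rule that[of "G *v (N *v c)"])
    show "Q *v (N *v (G *v (N *v c))) = 0" unfolding c_def by (rule QMGMGM[OF N(1) z])
    fix M assume M: "M \<in> S"
    show "\<exists>v1\<in>U. \<exists>v2\<in>U. Q *v (M *v (G *v (N *v c))) + Q *v (N *v v1) = 0 \<and> Q *v (M *v v1) + Q *v (N *v v2) = 0"
    proof (intro bexI conjI)
      \<comment> \<open>Here v(M) = GMGMz, expanded at N + sM with c = GNz.\<close>
      let ?v1 = "G *v (M *v c) + G *v (N *v (G *v (M *v z)))"
      let ?v2 = "G *v (M *v (G *v (M *v z)))"
      show "Q *v (M *v (G *v (N *v c))) + Q *v (N *v ?v1) = 0"
        using cubic[OF M N(1) z] by (simp add: c_def add.assoc)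
      show "Q *v (M *v ?v1) + Q *v (N *v ?v2) = 0"
        using cubic[OF N(1) M z] by (simp add: c_def add_ac)
      show "?v1 \<in> U" using vec.subspace_add[OF subspace_U] by simp
      show "?v2 \<in> U" by simp
    qed
  qed (use c' in simp_all)
qed

text \<open>QMe' is proportional to QMc for each \<open>M\<close>, and the factor is uniform because
  QMc fills \<open>R\<close>, of dimension 2. So for all QM at once, \<open>e'\<close> acts as a
  multiple of \<open>c\<close>, and \<open>x\<close> as a vector \<open>s\<close> of
  \<open>T z\<close>. This bounds dim V by r - 2 = 2, against 2r - 5 = 3.\<close>

lemma impossible: False
proof -
  obtain e' where e': "e' \<in> U" "e' \<notin> T z" "Q *v (N *v e') = 0"
    and ex: "\<And>M. M \<in> S \<Longrightarrow> \<exists>v1\<in>U. \<exists>v2\<in>U. Q *v (M *v e') + Q *v (N *v v1) = 0 \<and> Q *v (M *v v1) + Q *v (N *v v2) = 0"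
    using expansion by metis
  note R_add = vec.subspace_add[OF subspace_R] and R_scale = vec.subspace_scale[OF subspace_R]
    and R_neg = vec.subspace_neg[OF subspace_R] and R_diff = vec.subspace_diff[OF subspace_R]
  have dependent: "\<exists>k. Q *v (M *v e') = k *s (Q *v (M *v c))" if M: "M \<in> S" for M
  proof (cases "G *v (M *v z) \<in> vec.span {c}")
    case True
    then obtain a where a: "G *v (M *v z) = a *s c" by (rule span_singletonE)
    \<comment> \<open>\<open>L\<close> kills \<open>z\<close>, hence QL vanishes on \<open>U\<close>
      and QMe' = a QNe' = 0.\<close>
    define L where "L = M - mscale a N"
    have LS: "L \<in> S" unfolding L_def using ms_diff[OF ms M ms_scale[OF ms N(1)]] .
    have "G *v (L *v z) = 0" using a by (simp add: L_def c_def)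
    then have "L *v z = 0" using PG_range[OF QM_ker[OF LS z]] by simp
    then have "Q *v (L *v e') = 0" using QL_U[OF LS _ e'(1)] by simp
    then have "Q *v (M *v e') = 0" using e'(3) by (simp add: L_def)
    then show ?thesis by (intro exI[of _ 0]) simp
  next
    case False
    obtain v1 v2 where v: "v1 \<in> U" "v2 \<in> U" "Q *v (M *v e') + Q *v (N *v v1) = 0"
        "Q *v (M *v v1) + Q *v (N *v v2) = 0"
      using ex[OF M] by blast
    obtain f u where u: "u \<in> T z" "v1 = u + f *s e'" using decompose[OF e'(1,2) v(1)] .
    have Me: "Q *v (M *v e') = - (Q *v (N *v u))"
      using v(3) u(2) e'(3) by (simp add: eq_neg_iff_add_eq_0)
    have "Q *v (M *v u) = - (f *s (Q *v (M *v e')) + Q *v (N *v v2))"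
      using v(4) u(2) by (subst eq_neg_iff_add_eq_0) (simp add: add.assoc)
    then have "Q *v (M *v u) \<in> R"
      unfolding Me using R_neg R_diff R_scale QN_R by simp
    then obtain k l where "u = k *s (G *v (M *v z)) + l *s c"
      using pairing_regular[OF M False u(1)] span_pairE by blast
    then have "Q *v (M *v e') = k *s (Q *v (M *v c))"
      using Me QNc alt[OF M N(1) z] by (simp add: c_def vec.scale_minus_right)
    then show ?thesis by blast
  qed
  have R_c: "R = (*v) Q ` ev S c"
    unfolding R_def c_def using Q_ev_T[OF z N(1)] by simp
  have "2 \<le> vec.dim R" using dim_R_eq r_eq_4 by simp
  obtain a1 where a1: "a1 \<in> R" "a1 \<noteq> 0"
  proof -
    have "\<not> R \<subseteq> {0}" using \<open>2 \<le> vec.dim R\<close> vec.dim_eq_0[of R] by linarith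
    then show thesis using that by auto
  qed
  obtain a2 where a2: "a2 \<in> R" "a2 \<notin> vec.span {a1}"
  proof -
    have "\<not> R \<subseteq> vec.span {a1}"
    proof
      assume "R \<subseteq> vec.span {a1}"
      then have "vec.dim R \<le> card {a1}" by (intro vec.dim_le_card) simp_all
      then show False using \<open>2 \<le> vec.dim R\<close> by simp
    qed
    then show thesis using that by auto
  qed
  obtain M1 M2 where M12: "M1 \<in> S" "M2 \<in> S" "a1 = Q *v (M1 *v c)" "a2 = Q *v (M2 *v c)"
    using a1(1) a2(1) unfolding R_c by (auto simp: ev_def)
  have "\<exists>k. \<forall>M\<in>S. Q *v (M *v e') = k *s (Q *v (M *v c))"
  proof (rule common_factor[of "\<lambda>M. Q *v (M *v e')" "\<lambda>M. Q *v (M *v c)" S M1 M2])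
    show "Q *v (M1 *v c) \<noteq> 0" "Q *v (M2 *v c) \<notin> vec.span {Q *v (M1 *v c)}"
      using a1 a2 M12 by simp_all
  qed (use dependent M12 ms_add[OF ms] in simp_all)
  then obtain k where k: "\<And>M. M \<in> S \<Longrightarrow> Q *v (M *v e') = k *s (Q *v (M *v c))" by blast
  obtain f u where u: "u \<in> T z" "x = u + f *s e'" using decompose[OF e'(1,2) x(1)] .
  define s where "s = u + (f * k) *s c"
  have s: "s \<in> T z"
    unfolding s_def using vec.subspace_add[OF subspace_T u(1) vec.subspace_scale[OF subspace_T c_T]] .
  have "Q *v (M *v x) = Q *v (M *v s)" if "M \<in> S" for M
    using k[OF that] u(2) by (simp add: s_def vector_smult_assoc)
  then have Vs: "V = (*v) Q ` ev S s"
    unfolding V_def ev_def by (auto simp: image_iff) metis+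
  have dimV: "3 \<le> vec.dim V" using big r_eq_4 by simp
  show False
  proof (cases "s = 0")
    case True
    then have "V \<subseteq> {0}" unfolding Vs ev_def by auto
    then have "vec.dim V = 0" by (simp only: vec.dim_eq_0)
    then show False using dimV by linarith
  next
    case False
    then show False using dim_ev_le_in_T[OF z s] dimV dimT r_eq_4 unfolding Vs by linarith
  qed
qed

end

lemma (in corank_one) dim_V_bound:
  assumes "4 \<le> r"
  shows "vec.dim V + 6 \<le> 2 * r"
proof (rule ccontr)
  assume "\<not> ?thesis"
  then interpret extremal S P G z x x0 N
    using assms by unfold_locales linarith+
  show False by (rule impossible)
qed

section \<open>The bound for semi-primitive spaces\<close>

lemma two_choose_two: "2 * (n choose 2) = n * (n - 1)"
proof (induction n)
  case (Suc n)
  then show ?case by (cases n) (simp_all add: choose_two_Suc)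
qed simp

text \<open>The right side minus the left side is (q - 2)(r - q - 2).\<close>

lemma bound_split:
  assumes "2 \<le> q" "q + 2 \<le> r"
  shows "r + ((q choose 2) + ((r - q) choose 2)) \<le> 3 + ((r - 1) choose 2)"
proof -
  obtain a where a: "q = a + 2" using assms(1) by (metis add.commute le_Suc_ex)
  obtain b where b: "r = a + b + 4"
    using assms(2) a by (metis add.assoc add.commute le_Suc_ex numeral_Bit0)
  show ?thesis
    using two_choose_two[of q] two_choose_two[of "r - q"] two_choose_two[of "r - 1"]
    unfolding a b by (simp add: algebra_simps)
qed

lemma bound_linear:
  assumes "2 \<le> r"
  shows "max (2 * r - 2) (r + 1) \<le> 3 + ((r - 1) choose 2)"
proof -
  obtain a where a: "r = a + 2" using assms by (metis add.commute le_Suc_ex)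
  have le: "n \<le> n * n" for n :: nat by (cases n) auto
  \<comment> \<open>This is (a - 1)(a - 2) >= 0.\<close>
  have "3 * a \<le> a * a + 2"
    using le[of "a - 1"] by (cases a) auto
  moreover have "2 * ((r - 1) choose 2) = a * a + a"
    using two_choose_two[of "r - 1"] unfolding a by (simp add: algebra_simps)
  ultimately show ?thesis using le[of a] a by (intro max.boundedI) linarith+
qed

text \<open>Tight for v = 2r - 6 with r = 4 or r = 5, hence the improvement of
  \<open>dim_V_le\<close> by one.\<close>

lemma bound_corank_one:
  assumes "4 \<le> r" "v + 6 \<le> 2 * r"
  shows "r + v \<le> 3 + ((r - 1) choose 2)"
proof -
  obtain a where a: "r = a + 4" using assms by (metis add.commute le_Suc_ex)
  have "a \<le> a * a" by (cases a) auto
  moreover have "2 * ((r - 1) choose 2) = a * a + 5 * a + 6"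
    using two_choose_two[of "r - 1"] unfolding a by (simp add: algebra_simps)
  ultimately show ?thesis using assms(2) a by linarith
qed

text \<open>Each peeling step along a vector of \<open>Z\<close> costs at most one dimension per
  unit of rank. As \<open>Z\<close> spans, it goes on until all matrices vanish.\<close>

lemma dim_img_le_lines:
  fixes S :: "('a::field^'n^'m) set"
  assumes "vec.span Z = UNIV" "bounded_rank S r" "\<And>z. z \<in> Z \<Longrightarrow> vec.dim (ev S z) \<le> 1"
  shows "vec.dim (img S) \<le> r"
  using assms(2-)
proof (induction r arbitrary: S rule: less_induct)
  case (less r)
  have ms: "matrix_subspace S" using less.prems(1) by (rule bounded_rank_ms)
  show ?case
  proof (cases "comker S = UNIV")
    case True
    then show ?thesis using dim_img_comker[OF True] by linarith
  next
    case False
    have "\<not> Z \<subseteq> comker S"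
    proof
      assume "Z \<subseteq> comker S"
      then have "vec.span Z \<subseteq> comker S" using subspace_comker by (rule vec.span_minimal)
      then show False using False assms(1) by (metis top.extremum_uniqueI)
    qed
    then obtain z N where z: "z \<in> Z" and N: "N \<in> S" "N *v z \<noteq> 0" by (auto simp: comker_def)
    have r0: "0 < r" using rank_pos[OF N(2)] N(1) less.prems(1) by (fastforce simp: bounded_rank_def)
    obtain Q :: "'a^'m^'m" where Q: "\<And>y. Q *v y = 0 \<longleftrightarrow> y \<in> ev S z"
      using annihilator_exists[OF subspace_ev[OF ms]] by metis
    have "vec.dim (img (lmul Q S)) \<le> r - 1"
    proof (rule less.IH)
      show "bounded_rank (lmul Q S) (r - 1)"
        by (rule bounded_rank_quotient[OF less.prems(1) N Q])
      show "vec.dim (ev (lmul Q S) z') \<le> 1" if "z' \<in> Z" for z'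
        using less.prems(2)[OF that] vec.dim_image_le[of "(*v) Q" "ev S z'"]
        unfolding ev_lmul by (simp add: le_trans)
    qed (use r0 in simp)
    then show ?thesis
      using dim_img_lmul[OF ms Q] less.prems(2)[OF z] r0 by linarith
  qed
qed

lemma semi_primitive_bound:
  fixes S :: "('a::field^'n^'m) set"
  assumes S: "bounded_rank S r" and r2: "2 \<le> r" and ks: "kernels_span S r" and ck: "comker S = {0}"
  shows "vec.dim (ev S x) \<le> 3 + ((r - 1) choose 2)"
proof -
  have ms: "matrix_subspace S" using S by (rule bounded_rank_ms)
  have cp: "colprop S" using kernels_span_colprop[OF S ks] .
  have r_le: "r \<le> 3 + ((r - 1) choose 2)" using bound_linear[OF r2] by simp
  have frame: "\<exists>G. normal_form S P G \<and> G *v (P *v v) = v"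
    if P: "P \<in> S" "rank P = r" and v: "P *v v \<noteq> 0" for P v
  proof -
    obtain G :: "'a^'m^'n" where "\<And>v. P *v (G *v (P *v v)) = P *v v"
      "\<And>w. G *v (P *v (G *v w)) = G *v w" "G *v (P *v v) = v"
      using pseudo_inverse_exists[OF v] by metis
    moreover from this have "normal_form S P G"
      using S P r2 by unfold_locales simp_all
    ultimately show ?thesis by blast
  qed
  have in_ker: "vec.dim (ev S x) \<le> 3 + ((r - 1) choose 2)"
    if "P \<in> S" "rank P = r" "P *v x = 0" for P
    using dim_ev_le_rank[of S P x] S that r_le by simp
  have q_le: "vec.dim (ev S z) \<le> r" if "P \<in> S" "rank P = r" "P *v z = 0" for P z
    using dim_ev_le_rank[of S P z] S that by simp
  consider
      (middle) P z where "P \<in> S" "rank P = r" "P *v z = 0" "2 \<le> vec.dim (ev S z)" "vec.dim (ev S z) + 2 \<le> r"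
    | (full) P z where "P \<in> S" "rank P = r" "P *v z = 0" "vec.dim (ev S z) = r"
    | (corank) P z where "P \<in> S" "rank P = r" "P *v z = 0" "vec.dim (ev S z) + 1 = r" "3 \<le> r"
    | (lines) "\<And>P z. P \<in> S \<Longrightarrow> rank P = r \<Longrightarrow> P *v z = 0 \<Longrightarrow> vec.dim (ev S z) \<le> 1"
  proof (cases "\<forall>P z. P \<in> S \<longrightarrow> rank P = r \<longrightarrow> P *v z = 0 \<longrightarrow> vec.dim (ev S z) \<le> 1")
    case True
    then show thesis using lines by blast
  next
    case False
    then obtain P z where P: "P \<in> S" "rank P = r" "P *v z = 0" and "\<not> vec.dim (ev S z) \<le> 1" by blast
    then have q2: "2 \<le> vec.dim (ev S z)" by linarith
    consider "vec.dim (ev S z) + 2 \<le> r" | "vec.dim (ev S z) = r" | "vec.dim (ev S z) + 1 = r"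
      using q_le[OF P] by linarith
    then show thesis
    proof cases
      case 1 then show thesis using middle[OF P q2] by blast
    next
      case 2 then show thesis using full[OF P] by blast
    next
      case 3
      then have "3 \<le> r" using q2 by linarith
      with 3 show thesis using corank[OF P] by blast
    qed
  qed
  then show ?thesis
  proof cases
    case middle
    obtain v where v: "P *v v \<noteq> 0"
    proof -
      have "P \<noteq> 0" using middle(2) r2 rank_zero_field[where 'a='a and 'n='n and 'm='m] by auto
      then show thesis using that matrix_eqI[of P 0] by auto
    qed
    obtain G where "normal_form S P G" using frame[OF middle(1,2) v] by blast
    then interpret normal_form S P G .
    have "(*v) Q ` ev S x \<subseteq> img (lmul Q S)" using ev_sub_img[of "lmul Q S" x] by (simp only: ev_lmul)
    then have "vec.dim ((*v) Q ` ev S x) \<le> vec.dim (img (lmul Q S))" by (rule vec.dim_subset)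
    then show ?thesis
      using dim_ev_le[of x] dim_lower_le[OF middle(3) cp] bound_split[OF middle(4,5)]
      unfolding middle(2) by linarith
  next
    case full
    show ?thesis
    proof (cases "P *v x = 0")
      case True
      then show ?thesis using in_ker full(1,2) by blast
    next
      case False
      then obtain G where G: "normal_form S P G" "G *v (P *v x) = x" using frame[OF full(1,2)] by blast
      interpret normal_form S P G by (rule G(1))
      have "x \<in> U" "x \<noteq> 0" using G(2) G_in_U[of "P *v x"] False by auto
      then have "vec.dim (ev S x) \<le> max (2 * r - 2) (r + 1)"
        using full_case[OF full(3), of x] full(2,4) by simp
      then show ?thesis using bound_linear[OF r2] by (rule le_trans)
    qed
  next
    case corank
    show ?thesis
    proof (cases "P *v x = 0")
      case True
      then show ?thesis using in_ker corank(1,2) by blast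
    next
      case False
      then obtain G where G: "normal_form S P G" "G *v (P *v x) = x" using frame[OF corank(1,2)] by blast
      interpret normal_form S P G by (rule G(1))
      have x: "x \<in> U" "x \<noteq> 0" using G(2) G_in_U[of "P *v x"] False by auto
      show ?thesis
      proof (cases "x \<in> T z")
        case True
        have "vec.dim ((*v) Q ` ev S x) + 1 \<le> vec.dim (T z)"
          using dim_ev_le_in_T[OF corank(3) True x(2)] .
        then have "vec.dim (ev S x) \<le> 2 * r - 2"
          using dim_ev_le[of x] dim_T[OF corank(3)] corank(2,4) by linarith
        then show ?thesis using bound_linear[OF r2] by simp
      next
        case xT: False
        \<comment> \<open>\<open>T z\<close> pulled back along GP, a proper subspace since it omits
          \<open>x\<close>. Kernels of matrices of rank \<open>r\<close> cannot all lie in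
          it.\<close>
        let ?H = "{v. G *v (P *v v) \<in> T z}"
        have "vec.subspace ?H"
          using subspace_T[of z] by (simp add: vec.subspace_def)
        moreover have "x \<notin> ?H" using xT G(2) by simp
        then have "?H \<noteq> UNIV" by blast
        ultimately obtain N x0 where N: "N \<in> S" "rank N = r" "N *v x0 = 0" "x0 \<notin> ?H"
          using ks unfolding kernels_span_def by metis
        interpret corank_one S P G z x x0 N
          using corank N x(1) xT by unfold_locales simp_all
        show ?thesis
        proof (cases "4 \<le> r")
          case True
          then have "vec.dim V + 6 \<le> 2 * r" using dim_V_bound corank(2) by simp
          then have "r + vec.dim V \<le> 3 + ((r - 1) choose 2)" using bound_corank_one[OF True] by simp
          then show ?thesis using dim_ev_le[of x] corank(2) unfolding V_def by linarith
        next
          case False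
          then have "r = 3" using corank(5) by simp
          then show ?thesis using dim_ev_le[of x] dim_V_le corank(2) unfolding V_def by simp
        qed
      qed
    qed
  next
    case lines
    define Z where "Z = {z. \<exists>P\<in>S. rank P = r \<and> P *v z = 0}"
    have "vec.span Z = UNIV"
    proof (rule ccontr)
      assume "vec.span Z \<noteq> UNIV"
      then obtain M v where "M \<in> S" "rank M = r" "M *v v = 0" "v \<notin> vec.span Z"
        using ks vec.subspace_span unfolding kernels_span_def by metis
      then show False using vec.span_base[of v Z] by (auto simp: Z_def)
    qed
    then have "vec.dim (img S) \<le> r"
      using S by (rule dim_img_le_lines) (use lines in \<open>auto simp: Z_def\<close>)
    then show ?thesis using vec.dim_subset[OF ev_sub_img[of S x]] r_le by linarith
  qed
qed

section \<open>Coordinates\<close>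

lemma card_complement: "card (- d) = CARD('n) - card (d :: 'n::finite set)"
  by (simp add: Compl_eq_Diff_UNIV card_Diff_subset)

text \<open>The columns of \<open>A\<close> indexed by \<open>d\<close> form a basis of
  \<open>U\<close> and the others extend it. Index types carry no order, so any index set of the
  right size serves.\<close>

lemma adapted_basis:
  fixes U :: "('a::field^'n) set"
  assumes U: "vec.subspace U" and d: "card d = vec.dim U"
  obtains A :: "'a^'n^'n" where "invertible A" "\<And>x. A *v x \<in> U \<longleftrightarrow> (\<forall>i. i \<notin> d \<longrightarrow> x $ i = 0)"
proof -
  obtain B where B: "B \<subseteq> U" "vec.independent B" "vec.span B = U" "card B = vec.dim U"
    using vec.basis_subspace_exists[OF U] by metis
  obtain B' where B': "B \<subseteq> B'" "vec.independent B'" "vec.span B' = UNIV"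
    using vec.extend_basis_superset[OF B(2)] vec.independent_extend_basis[OF B(2)]
      vec.span_extend_basis[OF B(2)] by metis
  have fin: "finite B'" using B'(2) vec.finiteI_independent by blast
  then have finB: "finite B" using B'(1) finite_subset by blast
  have cB': "card B' = CARD('n)"
    using vec.dim_span_eq_card_independent[OF B'(2)] B'(3) vec_dim_card[where 'a='a and 'n='n] by simp
  obtain g where g: "bij_betw g d B"
    using finite_same_card_bij[of d B] finB d B(4) by auto
  have "card (- d) = card (B' - B)"
    using card_complement[of d] card_Diff_subset[OF finB B'(1)] cB' d B(4) by simp
  then obtain h where h: "bij_betw h (- d) (B' - B)"
    using finite_same_card_bij[of "- d" "B' - B"] fin by auto
  define f where "f j = (if j \<in> d then g j else h j)" for j
  have fd: "bij_betw f d B" using g by (rule bij_betw_cong[THEN iffD1, rotated]) (simp add: f_def)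
  have fc: "bij_betw f (- d) (B' - B)" using h by (rule bij_betw_cong[THEN iffD1, rotated]) (simp add: f_def)
  have "bij_betw f (d \<union> - d) (B \<union> (B' - B))"
    by (rule bij_betw_combine[OF fd fc]) auto
  then have f: "bij_betw f UNIV B'" using B'(1) by (simp add: Un_absorb1)
  define A :: "'a^'n^'n" where "A = (\<chi> i j. f j $ i)"
  have A: "A *v x = (\<Sum>j\<in>UNIV. x $ j *s f j)" for x
    by (simp add: A_def matrix_vector_mult_def vec_eq_iff sum_component mult.commute)
  have ker: "x = 0" if x: "A *v x = 0" for x
  proof -
    have "(\<Sum>b\<in>B'. (x $ inv_into UNIV f b) *s b) = (\<Sum>j\<in>UNIV. x $ inv_into UNIV f (f j) *s f j)"
      using sum.reindex_bij_betw[OF f, of "\<lambda>b. (x $ inv_into UNIV f b) *s b"] by simp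
    also have "\<dots> = 0"
      using x A f by (simp add: bij_betw_def inv_into_f_f)
    finally have "x $ inv_into UNIV f b = 0" if "b \<in> B'" for b
      using vec.independentD[OF B'(2) fin order_refl _ that, of "\<lambda>b. x $ inv_into UNIV f b"] by simp
    then have "x $ j = 0" for j
      using f by (metis UNIV_I bij_betw_def image_eqI inv_into_f_f)
    then show ?thesis by (simp add: vec_eq_iff)
  qed
  then have "invertible A"
    using matrix_left_invertible_ker[of A] invertible_left_inverse[of A] by blast
  moreover have "A *v x \<in> U \<longleftrightarrow> (\<forall>i. i \<notin> d \<longrightarrow> x $ i = 0)" for x
  proof -
    have split: "A *v x = (\<Sum>j\<in>d. x $ j *s f j) + (\<Sum>j\<in>-d. x $ j *s f j)"
      unfolding A using sum.union_disjoint[of d "- d" "\<lambda>j. x $ j *s f j"] by simp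
    have in1: "(\<Sum>j\<in>d. x $ j *s f j) \<in> vec.span B"
      using fd by (intro vec.span_sum vec.span_scale vec.span_base) (auto simp: bij_betw_def)
    have in2: "(\<Sum>j\<in>-d. x $ j *s f j) \<in> vec.span (B' - B)"
      using fc by (intro vec.span_sum vec.span_scale vec.span_base) (auto simp: bij_betw_def)
    show ?thesis
    proof
      assume "A *v x \<in> U"
      then have "A *v x \<in> vec.span B" using B(3) by simp
      then have "(\<Sum>j\<in>-d. x $ j *s f j) \<in> vec.span B"
        using vec.span_diff[OF _ in1, of "A *v x"] split by simp
      moreover have "vec.span B \<inter> vec.span (B' - B) = {0}"
        using B'(1,2) by (intro span_Int_independent) (simp_all add: Un_absorb1)
      ultimately have z: "(\<Sum>j\<in>-d. x $ j *s f j) = 0" using in2 by blast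
      define y where "y = (\<chi> j. if j \<in> d then 0 else x $ j)"
      have "A *v y = (\<Sum>j\<in>-d. x $ j *s f j)"
        unfolding A by (rule sum.mono_neutral_cong_right) (auto simp: y_def)
      then have "y = 0" using z ker by simp
      moreover have "x $ i = y $ i" if "i \<notin> d" for i using that by (simp add: y_def)
      ultimately show "\<forall>i. i \<notin> d \<longrightarrow> x $ i = 0" by simp
    next
      assume "\<forall>i. i \<notin> d \<longrightarrow> x $ i = 0"
      then have "(\<Sum>j\<in>-d. x $ j *s f j) = 0" by (intro sum.neutral) simp
      then show "A *v x \<in> U" using split in1 B(3) by simp
    qed
  qed
  ultimately show thesis using that by blast
qed

text \<open>If \<open>M\<close> is injective from K^n/U to K^m/SU, then in bases adapted to
  \<open>U\<close> and SU the lower block of \<open>M\<close> has independent columns.\<close>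

lemma column_property_colprop:
  fixes S :: "('a::field^'n^'m) set"
  assumes cp: "column_property S"
  shows "colprop S"
  unfolding colprop_def
proof (intro allI impI ballI, rule ccontr)
  fix U M assume U: "vec.subspace U" "U \<noteq> UNIV" and M: "M \<in> S"
    and "\<not> (\<exists>x. x \<notin> U \<and> M *v x \<in> spanned S U)"
  then have inj: "\<And>x. M *v x \<in> spanned S U \<Longrightarrow> x \<in> U" by blast
  have subR: "vec.subspace (spanned S U)" by (simp add: spanned_def)
  have dn: "vec.dim U < CARD('n)"
    using vec.subspace_dim_equal[OF U(1) vec.subspace_UNIV] U(2) vec_dim_card[where 'a='a and 'n='n]
    by (metis not_le subset_UNIV)
  obtain d :: "'n set" where d: "card d = vec.dim U"
    using obtain_subset_with_card_n[of "vec.dim U" "UNIV :: 'n set"] dn by (metis less_imp_le)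
  have "vec.dim (spanned S U) \<le> CARD('m)"
    using vec.dim_subset[OF subset_UNIV, of "spanned S U"] vec_dim_card[where 'a='a and 'n='m] by simp
  then obtain e :: "'m set" where e: "card e = vec.dim (spanned S U)"
    using obtain_subset_with_card_n[of "vec.dim (spanned S U)" "UNIV :: 'm set"] by metis
  obtain A :: "'a^'n^'n" where A: "invertible A" "\<And>x. A *v x \<in> U \<longleftrightarrow> (\<forall>i. i \<notin> d \<longrightarrow> x $ i = 0)"
    using adapted_basis[OF U(1) d] by metis
  obtain A' :: "'a^'m^'m" where A': "invertible A'"
      "\<And>x. A' *v x \<in> spanned S U \<longleftrightarrow> (\<forall>i. i \<notin> e \<longrightarrow> x $ i = 0)"
    using adapted_basis[OF subR e] by metis
  obtain F where F: "A' ** F = mat 1" "F ** A' = mat 1"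
    using A'(1) by (auto simp: invertible_def)
  then have invF: "invertible F" by (auto simp: invertible_def)
  have FR: "w \<in> spanned S U \<longleftrightarrow> (\<forall>i. i \<notin> e \<longrightarrow> (F *v w) $ i = 0)" for w
    using A'(2)[of "F *v w"] F(1) by (metis matrix_vector_mul_assoc matrix_vector_mul_lid)
  define S' where "S' = (\<lambda>N. F ** N ** A) ` S"
  have equiv: "mat_equiv S' S"
    unfolding mat_equiv_def S'_def using invF A(1) by blast
  have entry: "N $ i $ j = (N *v axis j 1) $ i" for N :: "'a^'n^'m" and i j
    by (simp add: matrix_vector_mult_def axis_def if_distrib cong: if_cong)
  \<comment> \<open>The columns in \<open>d\<close> represent \<open>U\<close> and form the
    right-hand part, so the left columns are those in \<open>- d\<close>.\<close>
  have dec: "decomposed S' (card e) (card (- d)) e (- d)"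
    unfolding decomposed_def
  proof (intro conjI ballI allI impI refl)
    show "1 \<le> card (- d)" using d dn card_complement[of d] by simp
    fix N i j assume N: "N \<in> S'" and i: "i \<notin> e" and j: "j \<notin> - d"
    obtain N0 where N0: "N0 \<in> S" "N = F ** N0 ** A" using N by (auto simp: S'_def)
    have "A *v axis j 1 \<in> U" unfolding A(2) using j by (auto simp: axis_def)
    then have "N0 *v (A *v axis j 1) \<in> spanned S U"
      unfolding spanned_def using N0(1) by (intro vec.span_base) blast
    then have "(F *v (N0 *v (A *v axis j 1))) $ i = 0" using FR i by blast
    then show "N $ i $ j = 0" unfolding entry[of N] unfolding N0(2) mm_mv .
  qed
  let ?M = "F ** M ** A"
  define w :: "'n \<Rightarrow> 'a^'m" where "w j = (\<chi> i. if i \<in> - e then ?M $ i $ j else 0)" for j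
  have lin: "\<forall>j\<in>- d. a j = 0" if a: "(\<Sum>j\<in>-d. a j *s w j) = 0" for a
  proof -
    define x where "x = (\<chi> j. if j \<in> d then 0 else a j)"
    have "(?M *v x) $ i = 0" if i: "i \<notin> e" for i
    proof -
      have "(?M *v x) $ i = (\<Sum>j\<in>-d. ?M $ i $ j * a j)"
        unfolding matrix_vector_mult_def vec_lambda_beta
        by (rule sum.mono_neutral_cong_right) (auto simp: x_def)
      also have "\<dots> = (\<Sum>j\<in>-d. a j *s w j) $ i"
        using i by (simp add: sum_component w_def mult.commute)
      finally show ?thesis using a by simp
    qed
    then have "M *v (A *v x) \<in> spanned S U" using FR by simp
    then have "\<forall>i. i \<notin> d \<longrightarrow> x $ i = 0" using inj A(2) by blast
    then show ?thesis by (auto simp: x_def)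
  qed
  \<comment> \<open>\<open>lin\<close> is indexed by columns, whereas \<open>subrank\<close> forms a
    set of vectors, where equal columns would merge.\<close>
  have injw: "inj_on w (- d)"
  proof (rule inj_onI, rule ccontr)
    fix j k assume jk: "j \<in> - d" "k \<in> - d" "w j = w k" "j \<noteq> k"
    have "(\<Sum>l\<in>-d. (if l = j then 1 else if l = k then -1 else 0) *s w l)
        = (\<Sum>l\<in>{j, k}. (if l = j then 1 else if l = k then -1 else 0) *s w l)"
      using jk by (intro sum.mono_neutral_right) auto
    also have "\<dots> = 0" using jk by (simp add: vec.scale_minus_left)
    finally show False
      using lin[of "\<lambda>l. if l = j then 1 else if l = k then -1 else 0"] jk(1) by force
  qed
  have "vec.independent (w ` (- d))"
  proof (rule vec.independent_if_scalars_zero)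
    fix u v assume "(\<Sum>b\<in>w ` (- d). u b *s b) = 0" and v: "v \<in> w ` (- d)"
    then have "(\<Sum>j\<in>-d. u (w j) *s w j) = 0" by (simp add: sum.reindex[OF injw])
    then show "u v = 0" using lin[of "\<lambda>j. u (w j)"] v by auto
  qed simp
  then have "vec.dim (w ` (- d)) = card (- d)"
    using card_image[OF injw] by (simp add: vec.dim_eq_card_independent)
  moreover have "w ` (- d) = {(\<chi> i. if i \<in> - e then ?M $ i $ j else 0) | j. j \<in> - d}"
    by (auto simp: w_def)
  ultimately have "subrank ?M (- e) (- d) = card (- d)"
    by (simp add: subrank_def)
  moreover have "?M \<in> S'" using M by (simp add: S'_def)
  ultimately show False
    using cp equiv dec unfolding column_property_def lower_defective_def by metis
qed

section \<open>Translating hypotheses and conclusion\<close>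

lemma urk_attained:
  fixes S :: "('a::field^'n^'m) set"
  assumes "matrix_subspace S"
  shows "\<exists>P\<in>S. rank P = urk S" and "\<And>M. M \<in> S \<Longrightarrow> rank M \<le> urk S"
proof -
  have "rank ` S \<subseteq> {..CARD('m)}" using rank_le_rows by auto
  then have fin: "finite (rank ` S)" by (rule finite_subset) simp
  have "rank ` S \<noteq> {}" using ms_zero[OF assms] by auto
  then have "urk S \<in> rank ` S" unfolding urk_def using fin by (intro Max_in)
  then show "\<exists>P\<in>S. rank P = urk S" by auto
  show "rank M \<le> urk S" if "M \<in> S" for M
    unfolding urk_def using fin that by (intro Max_ge) auto
qed

lemma trk_le:
  fixes S :: "('a::field^'n^'m) set"
  assumes "\<And>x. vec.dim (ev S x) \<le> b"
  shows "trk S \<le> b"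
proof -
  let ?D = "{vec.dim {M *v x | M. M \<in> S} | x. True}"
  have "?D \<subseteq> {..b}" using assms by (auto simp: ev_def)
  moreover from this have "finite ?D" by (rule finite_subset) simp
  moreover have "?D \<noteq> {}" by blast
  ultimately show ?thesis unfolding trk_def by (subst Max_le_iff) auto
qed

lemma defectiveness_index_eq:
  fixes S :: "('a::field^'n^'m) set"
  assumes "matrix_subspace S"
  shows "defectiveness_index S = CARD('n) - urk S"
  unfolding defectiveness_index_def
proof (rule Greatest_equality)
  show "c_defective_on S UNIV (CARD('n) - urk S)"
    unfolding c_defective_on_def
  proof
    fix M assume "M \<in> S"
    then show "CARD('n) - urk S \<le> vec.dim {x \<in> UNIV. M *v x = 0}"
      using urk_attained(2)[OF assms, of M] rank_ker[of M] by simp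
  qed
next
  fix c assume c: "c_defective_on S UNIV c"
  obtain P where "P \<in> S" "rank P = urk S" using urk_attained(1)[OF assms] by blast
  then show "c \<le> CARD('n) - urk S"
    using c rank_ker[of P] by (auto simp: c_defective_on_def)
qed

text \<open>With r = urk S, some \<open>M\<close> kills less than n - r dimensions of
  \<open>H\<close>. A hyperplane cuts a kernel by at most one dimension, so the kernel of
  \<open>M\<close> has dimension exactly n - r and leaves \<open>H\<close>.\<close>

lemma semi_primitive_kernels_span:
  fixes S :: "('a::field^'n^'m) set"
  assumes ms: "matrix_subspace S" and sp: "semi_primitive S"
  shows "kernels_span S (urk S)"
  unfolding kernels_span_def
proof (intro allI impI)
  fix U :: "('a^'n) set" assume U: "vec.subspace U" "U \<noteq> UNIV"
  obtain H where H: "vec.subspace H" "U \<subseteq> H" "vec.dim H = CARD('n) - 1" "H \<noteq> UNIV"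
    using subspace_in_hyperplane[OF U] by metis
  have "\<not> c_defective_on S H (CARD('n) - urk S)"
    using sp H(1,3) unfolding semi_primitive_def defectiveness_index_eq[OF ms] by blast
  then obtain M where M: "M \<in> S" "vec.dim {x\<in>H. M *v x = 0} < CARD('n) - urk S"
    by (auto simp: c_defective_on_def not_le)
  let ?K = "{x. M *v x = 0}"
  have HK: "H \<inter> ?K = {x\<in>H. M *v x = 0}" by auto
  have "vec.dim {a + b | a b. a \<in> H \<and> b \<in> ?K} \<le> CARD('n)"
    by (rule order_trans[OF vec.dim_subset[OF subset_UNIV]]) (simp only: vec_dim_card order_refl)
  then have "vec.dim H + vec.dim ?K \<le> CARD('n) + vec.dim {x\<in>H. M *v x = 0}"
    using vec.dim_sums_Int[OF H(1) subspace_ker[of M]] HK by simp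
  then have rk: "rank M = urk S"
    using M(2) H(3) rank_ker[of M] urk_attained(2)[OF ms M(1)] by linarith
  have "\<not> ?K \<subseteq> H"
  proof
    assume "?K \<subseteq> H"
    then have "{x\<in>H. M *v x = 0} = ?K" by auto
    then show False using M(2) rank_ker[of M] rk by simp
  qed
  then show "\<exists>M\<in>S. rank M = urk S \<and> (\<exists>x. M *v x = 0 \<and> x \<notin> U)"
    using M(1) rk H(2) by blast
qed

text \<open>With r = urk S, each matrix kills at least n - r of the n - 1 dimensions of
  \<open>H\<close>, so peeling inside \<open>H\<close> starts at rank r - 1.\<close>

lemma not_semi_primitive_dim_img_le:
  fixes S :: "('a::field^'n^'m) set"
  assumes S: "bounded_rank S (urk S)" and red: "reduced S" and nsp: "\<not> semi_primitive S"
    and cp: "colprop S" and pos: "0 < urk S"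
  shows "vec.dim (img S) \<le> urk S choose 2"
proof -
  have ms: "matrix_subspace S" using S by (rule bounded_rank_ms)
  obtain H where H: "vec.subspace H" "vec.dim H = CARD('n) - 1"
      "c_defective_on S H (CARD('n) - urk S)"
    using nsp red unfolding semi_primitive_def defectiveness_index_eq[OF ms] by blast
  obtain E :: "'a^'n^'n" where E: "\<And>x. E *v x \<in> H" "\<And>x. x \<in> H \<Longrightarrow> E *v x = x"
    using projection_exists[OF H(1)] by metis
  obtain P where P: "P \<in> S" "rank P = urk S" using urk_attained(1)[OF ms] by blast
  have "rank (M ** E) \<le> urk S - 1" if M: "M \<in> S" for M
  proof -
    have "CARD('n) - urk S \<le> vec.dim {x\<in>H. M *v x = 0}"
      using H(3) M by (simp add: c_defective_on_def)
    then show ?thesis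
      using rank_mul_projection[OF H(1) E, of M] H(2) rank_ker[of P] P(2) by linarith
  qed
  then have "bounded_rank (rmul S E) (urk S - 1)"
    using S matrix_subspace_rmul[OF ms, of E] exceeds_mono[of "UNIV :: 'a set" "urk S" "urk S - 1"]
    by (auto simp: bounded_rank_def rmul_def)
  then have "vec.dim (img S) \<le> Suc (urk S - 1) choose 2"
    using colprop_dim_img_le_hyperplane[OF H(1,2) E ms _ cp] by blast
  then show ?thesis using pos by simp
qed

theorem mainTheorem6:
  fixes S :: "('a::field^'n^'m) set"
  assumes "matrix_subspace S"
    and "reduced S"
    and "infinite (UNIV :: 'a set) \<or> urk S < CARD('a)"
    and "2 \<le> urk S"
  shows "(column_property S \<and> 4 \<le> urk S \<longrightarrow> trk S \<le> urk S choose 2)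
       \<and> (semi_primitive S \<longrightarrow> trk S \<le> 3 + ((urk S - 1) choose 2))"
proof -
  have S: "bounded_rank S (urk S)"
    using assms(1,3) urk_attained(2)[OF assms(1)] by (auto simp: bounded_rank_def exceeds_def)
  have ck: "comker S = {0}"
    using assms(2) by (auto simp: reduced_def comker_def)
  have b: "trk S \<le> 3 + ((urk S - 1) choose 2)" if "semi_primitive S"
    using semi_primitive_bound[OF S assms(4) semi_primitive_kernels_span[OF assms(1) that] ck]
    by (rule trk_le)
  have a: "trk S \<le> urk S choose 2" if cp: "column_property S" and r4: "4 \<le> urk S"
  proof (cases "semi_primitive S")
    case True
    \<comment> \<open>The difference of the two sides is r - 4.\<close>
    have "3 + ((urk S - 1) choose 2) \<le> urk S choose 2"
      using choose_two_Suc[of "urk S - 1"] r4 by simp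
    then show ?thesis using b[OF True] by linarith
  next
    case False
    have "vec.dim (img S) \<le> urk S choose 2"
      using not_semi_primitive_dim_img_le[OF S assms(2) False column_property_colprop[OF cp]] r4 by simp
    then have "vec.dim (ev S x) \<le> urk S choose 2" for x
      using vec.dim_subset[OF ev_sub_img[of S x]] by linarith
    then show ?thesis by (rule trk_le)
  qed
  show ?thesis using a b by blast
qed

end
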